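(* Let $W$ be a finite Coxeter group with set of simple reflections $S$. Let $J \subseteq S$ be such that the longest element $w_J$ of $W_J$ is central in $W_J$. Then the involution $w_J$ is special if and only if the parabolic subgroup $W_J$ is bulky in $W$.
   Context: $W$ is a finite Coxeter group generated by the set $S$ of simple reflections, with length function $l$ with respect to $S$. For $J \subseteq S$, $W_J = \langle J\rangle$ is the (standard) parabolic subgroup, and $w_J$ is the unique element of $W_J$ of maximal length. The term involution means an element $\sigma \in W$ with $\sigma^2 = 1$; the identity (which is $w_\emptyset$) is allowed. Special involutions. Let $\Phi$ be a root system with Coxeter group $W$ and let $V$ be the real span of $\Phi$, affording the usual reflection representation of $W$. For an involution $\sigma \in W$ write $V = V_1 \oplus V_{-1}$, where $V_1$ and $V_{-1}$ are the $1$- and $-1$-eigenspaces of $\sigma$ on $V$. For $\epsilon = \pm 1$ put $\Phi_\epsilon := \Phi \cap V_\epsilon$. The involution $\sigma$ is called special if for every root $\alpha \in \Phi$ there is $\epsilon \in \{1,-1\}$ such that the projection of $\alpha$ onto $V_\epsilon$ (with respect to $V = V_1 \oplus V_{-1}$) is proportional to a root in $\Phi_\epsilon$. This does not depend on the choice of root system $\Phi$ for $W$. Bulky parabolic subgroups. Let $D_J = \{x \in W : l(sx) > l(x) \text{ and } l(xs) > l(x) \text{ for all } s \in J\}$ and $N_J = \{x \in D_J : J^x = J\}$, where $J^x = x^{-1}Jx$. Then $N_J$ is a subgroup of $W$ and the normaliser of $W_J$ in $W$ is a semidirect product $N_W(W_J) = W_J \rtimes N_J$. The parabolic subgroup $W_J$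 is called bulky (in $W$) if $N_W(W_J) = W_J \times N_J$, i.e. if $N_J$ acts trivially on $W_J$ by conjugation. *)

theory Defs
  imports
    "HOL-Analysis.Analysis"
    "HOL-Algebra.Multiplicative_Group"
    "HOL-Algebra.Group_Action"
begin

section \<open>Coxeter systems\<close>

definition word_prod :: "('w, 'm) monoid_scheme \<Rightarrow> 'w list \<Rightarrow> 'w" where
  "word_prod W u = foldr (\<otimes>\<^bsub>W\<^esub>) u \<one>\<^bsub>W\<^esub>"

text \<open>
  Deletion of one relator \<open>(s t)\<^sup>m\<close>, where \<open>m\<close> is the order of \<open>s t\<close> in \<open>W\<close>. Taking \<open>s = t\<close>
  gives the relator \<open>s s\<close>; an infinite order is represented by \<open>m = 0\<close>, which gives no relation.
\<close>
inductive coxeter_step :: "('w, 'm) monoid_scheme \<Rightarrow> 'w set \<Rightarrow> 'w list \<Rightarrow> 'w list \<Rightarrow> bool"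
  for W S where
  "\<lbrakk>s \<in> S; t \<in> S; u \<in> lists S; v \<in> lists S\<rbrakk> \<Longrightarrow>
     coxeter_step W S (u @ concat (replicate (group.ord W (s \<otimes>\<^bsub>W\<^esub> t)) [s, t]) @ v) (u @ v)"

text \<open>
  The last conjunct says that \<open>W\<close> is presented by the generators \<open>S\<close> and the relators
  \<open>(s t)\<^bsup>m(s,t)\<^esup>\<close>. Since the relators contain \<open>s s\<close>, each generator is its own inverse, so words
  in \<open>S\<close> without formal inverses suffice.
\<close>
definition coxeter_system :: "('w, 'm) monoid_scheme \<Rightarrow> 'w set \<Rightarrow> bool" where
  "coxeter_system W S \<longleftrightarrow>
     group W \<and> S \<subseteq> carrier W \<and> generate W S = carrier W \<and>
     (\<forall>s\<in>S. s \<noteq> \<one>\<^bsub>W\<^esub> \<and> s \<otimes>\<^bsub>W\<^esub> s = \<one>\<^bsub>W\<^esub>) \<and>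
     (\<forall>u\<in>lists S. \<forall>v\<in>lists S.
        word_prod W u = word_prod W v \<longrightarrow> equivclp (coxeter_step W S) u v)"

definition cox_length :: "('w, 'm) monoid_scheme \<Rightarrow> 'w set \<Rightarrow> 'w \<Rightarrow> nat" where
  "cox_length W S w = (LEAST n. \<exists>u\<in>lists S. length u = n \<and> word_prod W u = w)"

text \<open>For finite \<open>W\<close> the element of maximal length of a standard parabolic subgroup is unique.\<close>
definition longest_element :: "('w, 'm) monoid_scheme \<Rightarrow> 'w set \<Rightarrow> 'w set \<Rightarrow> 'w" where
  "longest_element W S J = arg_max_on (cox_length W S) (generate W J)"

section \<open>Bulky parabolic subgroups\<close>

definition D_set :: "('w, 'm) monoid_scheme \<Rightarrow> 'w set \<Rightarrow> 'w set \<Rightarrow> 'w set" where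
  "D_set W S J = {x \<in> carrier W. \<forall>s\<in>J.
     cox_length W S (s \<otimes>\<^bsub>W\<^esub> x) > cox_length W S x \<and>
     cox_length W S (x \<otimes>\<^bsub>W\<^esub> s) > cox_length W S x}"

definition N_set :: "('w, 'm) monoid_scheme \<Rightarrow> 'w set \<Rightarrow> 'w set \<Rightarrow> 'w set" where
  "N_set W S J = {x \<in> D_set W S J. inv\<^bsub>W\<^esub> x <#\<^bsub>W\<^esub> J #>\<^bsub>W\<^esub> x = J}"

text \<open>
  The normaliser of \<open>W\<^sub>J\<close> is the internal direct product of \<open>W\<^sub>J\<close> and \<open>N\<^sub>J\<close>, that is, the
  multiplication map is an isomorphism.
\<close>
definition bulky :: "('w, 'm) monoid_scheme \<Rightarrow> 'w set \<Rightarrow> 'w set \<Rightarrow> bool" where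
  "bulky W S J \<longleftrightarrow>
     (\<lambda>(w, x). w \<otimes>\<^bsub>W\<^esub> x) \<in>
       iso (W\<lparr>carrier := generate W J\<rparr> \<times>\<times> W\<lparr>carrier := N_set W S J\<rparr>)
           (W\<lparr>carrier := normalizer W (generate W J)\<rparr>)"

section \<open>Root systems\<close>

definition reflection :: "'v::euclidean_space \<Rightarrow> 'v \<Rightarrow> 'v" where
  "reflection \<alpha> v = v - (2 * (v \<bullet> \<alpha>) / (\<alpha> \<bullet> \<alpha>)) *\<^sub>R \<alpha>"

text \<open>Root systems need be neither crystallographic nor spanning.\<close>
definition root_system :: "'v::euclidean_space set \<Rightarrow> bool" where
  "root_system \<Phi> \<longleftrightarrow>
     finite \<Phi> \<and> 0 \<notin> \<Phi> \<and>
     (\<forall>\<alpha>\<in>\<Phi>. \<Phi> \<inter> span {\<alpha>} = {\<alpha>, - \<alpha>} \<and> reflection \<alpha> ` \<Phi> = \<Phi>)"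

definition simple_roots :: "'v::euclidean_space set \<Rightarrow> 'v set \<Rightarrow> bool" where
  "simple_roots \<Phi> \<Delta> \<longleftrightarrow>
     \<Delta> \<subseteq> \<Phi> \<and> independent \<Delta> \<and>
     (\<forall>\<beta>\<in>\<Phi>. \<exists>c. \<beta> = (\<Sum>\<alpha>\<in>\<Delta>. c \<alpha> *\<^sub>R \<alpha>) \<and>
        ((\<forall>\<alpha>\<in>\<Delta>. c \<alpha> \<ge> 0) \<or> (\<forall>\<alpha>\<in>\<Delta>. c \<alpha> \<le> 0)))"

definition reflection_group :: "'v::euclidean_space set \<Rightarrow> ('v \<Rightarrow> 'v) monoid" where
  "reflection_group \<Phi> = (BijGroup UNIV)\<lparr>carrier := generate (BijGroup UNIV) (reflection ` \<Phi>)\<rparr>"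

text \<open>
  \<open>\<Phi>\<close> is a root system with Coxeter group \<open>W\<close>: the isomorphism \<open>\<rho>\<close> identifies \<open>W\<close> with the
  reflection group of \<open>\<Phi>\<close> and \<open>S\<close> with the reflections in some set of simple roots. The reflection
  representation of \<open>W\<close> is the restriction of \<open>\<rho>\<close> to \<open>V = span \<Phi>\<close>.
\<close>
definition root_system_for ::
  "('w, 'm) monoid_scheme \<Rightarrow> 'w set \<Rightarrow> 'v::euclidean_space set \<Rightarrow> ('w \<Rightarrow> 'v \<Rightarrow> 'v) \<Rightarrow> bool" where
  "root_system_for W S \<Phi> \<rho> \<longleftrightarrow>
     root_system \<Phi> \<and> \<rho> \<in> iso W (reflection_group \<Phi>) \<and>
     (\<exists>\<Delta>. simple_roots \<Phi> \<Delta> \<and> \<rho> ` S = reflection ` \<Delta>)"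

section \<open>Special involutions\<close>

definition eigen :: "'v::euclidean_space set \<Rightarrow> ('w \<Rightarrow> 'v \<Rightarrow> 'v) \<Rightarrow> 'w \<Rightarrow> real \<Rightarrow> 'v set" where
  "eigen \<Phi> \<rho> \<sigma> \<epsilon> = {v \<in> span \<Phi>. \<rho> \<sigma> v = \<epsilon> *\<^sub>R v}"

text \<open>The component in \<open>A\<close> of a vector of the direct sum \<open>A \<oplus> B\<close>.\<close>
definition proj_along :: "'v::euclidean_space set \<Rightarrow> 'v set \<Rightarrow> 'v \<Rightarrow> 'v" where
  "proj_along A B v = (THE p. p \<in> A \<and> v - p \<in> B)"

text \<open>
  The factor \<open>c\<close> may be \<open>0\<close>. This is harmless: if the projection of \<open>\<alpha>\<close> to one eigenspace
  vanishes, then \<open>\<alpha>\<close> lies in the other one and is its own projection there.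
\<close>
definition special_involution ::
  "('w, 'm) monoid_scheme \<Rightarrow> 'v::euclidean_space set \<Rightarrow> ('w \<Rightarrow> 'v \<Rightarrow> 'v) \<Rightarrow> 'w \<Rightarrow> bool" where
  "special_involution W \<Phi> \<rho> \<sigma> \<longleftrightarrow>
     \<sigma> \<in> carrier W \<and> \<sigma> \<otimes>\<^bsub>W\<^esub> \<sigma> = \<one>\<^bsub>W\<^esub> \<and>
     (\<forall>\<alpha>\<in>\<Phi>. \<exists>\<epsilon>\<in>{1, -1}. \<exists>\<beta>\<in>\<Phi> \<inter> eigen \<Phi> \<rho> \<sigma> \<epsilon>. \<exists>c.
        proj_along (eigen \<Phi> \<rho> \<sigma> \<epsilon>) (eigen \<Phi> \<rho> \<sigma> (- \<epsilon>)) \<alpha> = c *\<^sub>R \<beta>)"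

end

theory Submission
  imports Defs
begin

text \<open>
  Let \<open>\<sigma>\<close> be the longest element of \<open>W\<^sub>J\<close> and \<open>D\<close> the set of simple roots of \<open>J\<close>. Centrality makes
  \<open>\<sigma>\<close> act as \<open>-1\<close> on \<open>span D\<close> and as \<open>1\<close> on its orthogonal complement, and \<open>W\<^sub>J\<close> is bulky if and only
  if every element of \<open>W\<close> that permutes \<open>D\<close> fixes \<open>D\<close> pointwise. Both directions rest on the fact
  that \<open>W\<close> acts freely on its chambers.

  If \<open>\<sigma>\<close> is special and \<open>x\<close> permutes \<open>D\<close>, multiply \<open>x\<close> by an element of the group generated by the
  reflections in \<open>\<Phi>\<^sub>1\<close>, which fixes \<open>D\<close>, so that the product \<open>z\<close> maps some \<open>p \<in> V\<^sub>1\<close> into its own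
  \<open>\<Phi>\<^sub>1\<close>-chamber. There is also \<open>q \<in> span D\<close> fixed by \<open>z\<close> and orthogonal to no root of \<open>\<Phi>\<^sub>-\<^sub>1\<close>. By
  specialness a root orthogonal to \<open>q\<close> has a \<open>V\<^sub>1\<close>-component proportional to a root of \<open>\<Phi>\<^sub>1\<close>, so \<open>q\<close>
  plus a small multiple of \<open>p\<close> is mapped by \<open>z\<close> into its own chamber, whence \<open>z = 1\<close>.

  Conversely, let \<open>b\<close> be a root neither of whose components \<open>e \<in> V\<^sub>-\<^sub>1\<close> and \<open>f \<in> V\<^sub>1\<close> is proportional to
  a root. Then the plane of \<open>e\<close> and \<open>f\<close> supports an element \<open>y\<close> of \<open>W\<close> that acts there as \<open>-1\<close>. It
  normalises \<open>W\<^sub>J\<close>; if \<open>W\<^sub>J\<close> is bulky, then the \<open>W\<^sub>J\<close>-component of \<open>y\<close> is the reflection in \<open>e\<close>, and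
  every reflection in \<open>W\<close> is the reflection in a root.
\<close>

section \<open>Reflections and linear algebra\<close>

lemma reflection_linear: "linear (reflection a)"
  unfolding reflection_def
  by (rule linearI) (simp_all add: inner_add_left algebra_simps add_divide_distrib)

lemma reflection_self: "a \<noteq> 0 \<Longrightarrow> reflection a a = - a"
  by (simp add: reflection_def scaleR_2)

lemma reflection_fixes: "v \<bullet> a = 0 \<Longrightarrow> reflection a v = v"
  by (simp add: reflection_def)

lemma reflection_reflection: "reflection a (reflection a v) = v"
  by (cases "a = 0") (simp_all add: reflection_def inner_diff_left)

lemma reflection_inner: "reflection a x \<bullet> reflection a y = x \<bullet> y"
  by (cases "a = 0")
    (simp_all add: reflection_def inner_diff_left inner_diff_right inner_commute field_simps)

lemma reflection_bij: "bij (reflection a)"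
  by (rule o_bij[of "reflection a"]) (auto simp: fun_eq_iff reflection_reflection)

lemma reflection_conjugate:
  assumes "linear g" and "\<And>x y. g x \<bullet> g y = x \<bullet> y"
  shows "g (reflection a v) = reflection (g a) (g v)"
  using assms by (simp add: reflection_def linear_diff linear_scale)

text \<open>Evaluating both reflections at \<open>a\<close> gives \<open>- a\<close> on one side and
  \<open>a\<close> minus a multiple of \<open>b\<close> on the other.\<close>

lemma reflection_eq_imp_span:
  assumes "a \<noteq> 0" and "reflection a = reflection b"
  shows "a \<in> span {b}"
proof -
  have "- a = reflection b a"
    using reflection_self[OF assms(1)] assms(2) by simp
  then have "2 *\<^sub>R a = (2 * (a \<bullet> b) / (b \<bullet> b)) *\<^sub>R b"
    by (simp add: reflection_def scaleR_2 algebra_simps)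
  then have "a = ((a \<bullet> b) / (b \<bullet> b)) *\<^sub>R b"
    by (metis (no_types, opaque_lifting) scaleR_cancel_left scaleR_scaleR times_divide_eq_right zero_neq_numeral)
  then show ?thesis
    by (metis span_base span_scale singletonI)
qed

text \<open>A real vector space is not a finite union of proper subspaces. In the induction the
  vector found so far is perturbed along a direction that \<open>a\<close> detects.\<close>

lemma nonvanishing_vector:
  fixes U A :: "'v::real_inner set"
  assumes "finite A" and U: "subspace U" and "\<And>a. a \<in> A \<Longrightarrow> \<exists>u\<in>U. a \<bullet> u \<noteq> 0"
  shows "\<exists>u\<in>U. \<forall>a\<in>A. a \<bullet> u \<noteq> 0"
  using assms(1,3)
proof (induction A)
  case empty
  then show ?case
    using subspace_0[OF U] by blast
next
  case (insert a A)
  obtain u where u: "u \<in> U" "\<forall>b\<in>A. b \<bullet> u \<noteq> 0"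
    using insert by blast
  obtain v where v: "v \<in> U" "a \<bullet> v \<noteq> 0"
    using insert.prems by blast
  show ?case
  proof (cases "a \<bullet> u = 0")
    case True
    have "finite (insert 0 ((\<lambda>b. - (b \<bullet> u) / (b \<bullet> v)) ` A))"
      using insert.hyps by simp
    \<comment> \<open>Excluding \<open>0\<close> takes care of \<open>a\<close>; the other excluded
      values are those at which some \<open>b\<close> with \<open>b \<bullet> v \<noteq> 0\<close>
      would vanish.\<close>
    then obtain t where t: "t \<notin> insert 0 ((\<lambda>b. - (b \<bullet> u) / (b \<bullet> v)) ` A)"
      using ex_new_if_finite[OF infinite_UNIV_char_0] by blast
    have "b \<bullet> (u + t *\<^sub>R v) \<noteq> 0" if "b \<in> A" for b
    proof (cases "b \<bullet> v = 0")
      case False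
      then have "t \<noteq> - (b \<bullet> u) / (b \<bullet> v)"
        using t that by blast
      with False show ?thesis
        by (auto simp: inner_add_right field_simps)
    qed (use u that in \<open>simp add: inner_add_right\<close>)
    moreover have "a \<bullet> (u + t *\<^sub>R v) \<noteq> 0"
      using True v t by (simp add: inner_add_right)
    ultimately show ?thesis
      using u v by (intro bexI[of _ "u + t *\<^sub>R v"]) (auto simp: subspace_add subspace_scale U)
  qed (use u in blast)
qed

text \<open>For large \<open>t\<close> the term \<open>t *\<^sub>R g\<close> decides the sign of
  both factors; where \<open>a\<close> is orthogonal to \<open>g\<close>, the product does not
  depend on \<open>t\<close>.\<close>

lemma eventually_same_sign:
  fixes A :: "'v::real_inner set"
  assumes "finite A" and "\<And>a. a \<in> A \<Longrightarrow> a \<bullet> g \<noteq> 0 \<or> (a \<bullet> p) * (a \<bullet> q) > 0"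
  shows "\<exists>t. \<forall>a\<in>A. (a \<bullet> (p + t *\<^sub>R g)) * (a \<bullet> (q + t *\<^sub>R g)) > 0"
proof -
  have "eventually (\<lambda>t. (a \<bullet> (p + t *\<^sub>R g)) * (a \<bullet> (q + t *\<^sub>R g)) > 0) at_top"
    if "a \<in> A" for a
  proof (cases "a \<bullet> g = 0")
    case True
    then show ?thesis
      using assms(2)[OF that] by (simp add: inner_add_right)
  next
    case False
    define b where "b = a \<bullet> g"
    have "eventually (\<lambda>t. t > \<bar>a \<bullet> p\<bar> / \<bar>b\<bar>) at_top" "eventually (\<lambda>t. t > \<bar>a \<bullet> q\<bar> / \<bar>b\<bar>) at_top"
      by (rule eventually_gt_at_top)+
    then show ?thesis
    proof eventually_elim
      case (elim t)
      have "\<bar>b\<bar> > 0"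
        using False b_def by simp
      then have 1: "\<bar>a \<bullet> p\<bar> < t * \<bar>b\<bar>" and 2: "\<bar>a \<bullet> q\<bar> < t * \<bar>b\<bar>"
        using elim by (simp_all add: pos_divide_less_eq)
      show ?case
      proof (cases "b > 0")
        case True
        then have "a \<bullet> p + t * b > 0" "a \<bullet> q + t * b > 0"
          using 1 2 by auto
        then show ?thesis
          by (simp add: inner_add_right b_def[symmetric])
      next
        case False
        then have "a \<bullet> p + t * b < 0" "a \<bullet> q + t * b < 0"
          using 1 2 by (auto simp: abs_if split: if_splits)
        then show ?thesis
          by (simp add: inner_add_right b_def[symmetric] mult_neg_neg)
      qed
    qed
  qed
  then have "eventually (\<lambda>t. \<forall>a\<in>A. (a \<bullet> (p + t *\<^sub>R g)) * (a \<bullet> (q + t *\<^sub>R g)) > 0) at_top"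
    using assms(1) by (simp add: eventually_ball_finite)
  then show ?thesis
    using eventually_happens'[OF trivial_limit_at_top_linorder] by blast
qed

text \<open>The linear functional with value 1 on \<open>D\<close> is represented by a vector.
  Applied to simple roots this yields \<open>h\<close>, whose inner product with a root is the
  height of that root.\<close>

lemma independent_dual_vector:
  fixes D :: "'v::euclidean_space set"
  assumes "independent D"
  shows "\<exists>h. \<forall>a\<in>D. h \<bullet> a = 1"
proof -
  obtain f :: "'v \<Rightarrow> real" where f: "linear f" "\<forall>a\<in>D. f a = 1"
    using linear_independent_extend[OF assms, of "\<lambda>_. 1::real"] by auto
  have "adjoint f 1 \<bullet> a = f a" for a
    using adjoint_works[OF f(1), of a 1] by (simp add: inner_commute)
  with f(2) show ?thesis
    by metis
qed

lemma independent_coeffs_eq: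
  assumes "independent D" "finite D"
    and "(\<Sum>a\<in>D. c a *\<^sub>R a) = (\<Sum>a\<in>D. d a *\<^sub>R a)" "a \<in> D"
  shows "c a = d a"
proof -
  have "(\<Sum>a\<in>D. (c a - d a) *\<^sub>R a) = 0"
    using assms(3) by (simp add: scaleR_diff_left sum_subtractf)
  then have "c a - d a = 0"
    using independentD[OF assms(1,2) subset_refl _ assms(4), of "\<lambda>a. c a - d a"] by simp
  then show ?thesis by simp
qed

text \<open>The component of \<open>b\<close> orthogonal to \<open>span D\<close> is itself an
  admissible \<open>u\<close>, and \<open>b \<bullet> u = 0\<close> makes it vanish.\<close>

lemma in_span_if_perp_perp:
  fixes D :: "'v::euclidean_space set"
  assumes "\<And>u. (\<And>a. a \<in> D \<Longrightarrow> u \<bullet> a = 0) \<Longrightarrow> b \<bullet> u = 0"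
  shows "b \<in> span D"
proof -
  obtain y z where y: "y \<in> span D" and z: "\<And>w. w \<in> span D \<Longrightarrow> orthogonal z w" and b: "b = y + z"
    using orthogonal_subspace_decomp_exists[of D b] by metis
  have "b \<bullet> z = 0"
    using z by (intro assms) (auto simp: orthogonal_def span_base)
  moreover have "y \<bullet> z = 0"
    using z[OF y] by (simp add: orthogonal_def inner_commute)
  ultimately have "z = 0"
    using b by (simp add: inner_add_left)
  with b y show ?thesis by simp
qed

lemma perp_span:
  fixes D :: "'v::real_inner set"
  assumes "x \<in> span D" "\<And>a. a \<in> D \<Longrightarrow> v \<bullet> a = 0"
  shows "v \<bullet> x = 0"
  using assms(1)
proof (induction rule: span_induct)
  case base
  show ?case
    by (auto simp: subspace_def inner_add_right)
qed (use assms(2) in auto)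

lemma span_perp_zero:
  fixes D :: "'v::real_inner set"
  assumes "x \<in> span D" "\<And>a. a \<in> D \<Longrightarrow> x \<bullet> a = 0"
  shows "x = 0"
  using perp_span[OF assms] by simp

text \<open>The space is the sum of \<open>span D\<close> and its orthogonal complement. Group
  elements are compared this way below, since \<open>W\<^sub>J\<close> acts trivially on the
  complement.\<close>

lemma linear_eq_on_span_perp:
  fixes f g :: "'v::euclidean_space \<Rightarrow> 'v"
  assumes "linear f" "linear g" "\<And>a. a \<in> D \<Longrightarrow> f a = g a"
    and perp: "\<And>u. (\<And>a. a \<in> D \<Longrightarrow> u \<bullet> a = 0) \<Longrightarrow> f u = g u"
  shows "f v = g v"
proof -
  obtain y z where y: "y \<in> span D" and z: "\<And>w. w \<in> span D \<Longrightarrow> orthogonal z w" and v: "v = y + z"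
    using orthogonal_subspace_decomp_exists[of D v] by metis
  have "f y = g y"
    using linear_eq_on_span[OF assms(1,2,3) y] .
  moreover have "f z = g z"
    using z by (intro perp) (auto simp: orthogonal_def span_base)
  ultimately show ?thesis
    by (simp add: v linear_add assms(1,2))
qed

section \<open>The reflection representation\<close>

lemma word_prod_simps [simp]:
  "word_prod W [] = \<one>\<^bsub>W\<^esub>" "word_prod W (x # u) = x \<otimes>\<^bsub>W\<^esub> word_prod W u"
  by (simp_all add: word_prod_def)

text \<open>A root \<open>b\<close> is positive if and only if \<open>h \<bullet> b > 0\<close>.\<close>

locale coxeter_rep = group W for W :: "('w, 'm) monoid_scheme" (structure) +
  fixes S :: "'w set" and \<Phi> \<Delta> :: "'v::euclidean_space set"
    and \<rho> :: "'w \<Rightarrow> 'v \<Rightarrow> 'v" and h :: 'v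
  assumes finite_W: "finite (carrier W)"
    and generate_S: "generate W S = carrier W"
    and S_sq: "s \<in> S \<Longrightarrow> s \<otimes> s = \<one>"
    and S_sub: "S \<subseteq> carrier W"
    and roots: "root_system \<Phi>"
    and simple: "simple_roots \<Phi> \<Delta>"
    and iso: "\<rho> \<in> iso W (reflection_group \<Phi>)"
    and \<rho>_S: "\<rho> ` S = reflection ` \<Delta>"
    and h_simple: "a \<in> \<Delta> \<Longrightarrow> h \<bullet> a = 1"
begin

lemma finite_\<Phi>: "finite \<Phi>"
  and zero_notin_\<Phi>: "0 \<notin> \<Phi>"
  and \<Delta>_sub: "\<Delta> \<subseteq> \<Phi>"
  and indep_\<Delta>: "independent \<Delta>"
  using roots simple by (auto simp: root_system_def simple_roots_def)

lemma finite_\<Delta>: "finite \<Delta>"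
  using finite_subset[OF \<Delta>_sub finite_\<Phi>] .

lemma root_neg: "a \<in> \<Phi> \<Longrightarrow> - a \<in> \<Phi>"
  using roots by (force simp: root_system_def)

lemma root_span: "a \<in> \<Phi> \<Longrightarrow> b \<in> \<Phi> \<Longrightarrow> a \<in> span {b} \<Longrightarrow> a = b \<or> a = - b"
  using roots by (force simp: root_system_def)

lemma reflection_root: "a \<in> \<Phi> \<Longrightarrow> b \<in> \<Phi> \<Longrightarrow> reflection a b \<in> \<Phi>"
  using roots by (force simp: root_system_def)

section \<open>The action of \<open>W\<close> by orthogonal maps that permute the roots\<close>

lemma carrier_reflection_group:
  "carrier (reflection_group \<Phi>) = generate (BijGroup UNIV) (reflection ` \<Phi>)"
  by (simp add: reflection_group_def)

lemma Bij_UNIV: "Bij UNIV = {f. bij f}"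
  by (auto simp: Bij_def)

lemma reflection_group_Bij: "f \<in> carrier (reflection_group \<Phi>) \<Longrightarrow> bij f"
proof -
  interpret B: group "BijGroup (UNIV :: 'v set)"
    by (rule group_BijGroup)
  assume "f \<in> carrier (reflection_group \<Phi>)"
  moreover have "reflection ` \<Phi> \<subseteq> carrier (BijGroup UNIV)"
    by (auto simp: BijGroup_def Bij_UNIV reflection_bij)
  ultimately have "f \<in> carrier (BijGroup UNIV)"
    unfolding carrier_reflection_group using B.generate_in_carrier by blast
  then show ?thesis
    by (simp add: BijGroup_def Bij_UNIV)
qed

lemma BijGroup_mult:
  "bij f \<Longrightarrow> bij g \<Longrightarrow> f \<otimes>\<^bsub>BijGroup UNIV\<^esub> g = f \<circ> g"
  by (auto simp: BijGroup_def Bij_UNIV compose_def)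

lemma reflection_inv: "inv\<^bsub>BijGroup UNIV\<^esub> (reflection a) = reflection (a :: 'v)"
proof -
  interpret B: group "BijGroup (UNIV :: 'v set)"
    by (rule group_BijGroup)
  have "reflection a \<otimes>\<^bsub>BijGroup UNIV\<^esub> reflection a = \<one>\<^bsub>BijGroup UNIV\<^esub>"
    by (subst BijGroup_mult)
      (auto simp: reflection_bij BijGroup_def fun_eq_iff reflection_reflection)
  then show ?thesis
    by (intro B.inv_equality) (auto simp: BijGroup_def Bij_UNIV reflection_bij)
qed

lemma reflection_group_props:
  assumes "f \<in> generate (BijGroup UNIV) (reflection ` \<Phi>)"
  shows "linear f \<and> (\<forall>x y. f x \<bullet> f y = x \<bullet> y) \<and> (\<forall>a\<in>\<Phi>. f a \<in> \<Phi>)"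
  using assms
proof induction
  case one
  then show ?case
    by (simp add: BijGroup_def linear_id[unfolded id_def])
next
  case (incl f)
  then show ?case
    by (auto simp: reflection_linear reflection_inner reflection_root)
next
  case (inv f)
  then show ?case
    by (auto simp: reflection_inv reflection_linear reflection_inner reflection_root)
next
  case (eng f g)
  then have "f \<otimes>\<^bsub>BijGroup UNIV\<^esub> g = f \<circ> g"
    by (intro BijGroup_mult reflection_group_Bij) (simp_all add: carrier_reflection_group)
  with eng show ?case
    by (auto simp: linear_compose[unfolded o_def])
qed

lemma \<rho>_carrier: "w \<in> carrier W \<Longrightarrow> \<rho> w \<in> carrier (reflection_group \<Phi>)"
  using iso by (auto simp: iso_def bij_betw_def)

lemma \<rho>_linear: "w \<in> carrier W \<Longrightarrow> linear (\<rho> w)"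
  and \<rho>_inner: "w \<in> carrier W \<Longrightarrow> \<rho> w x \<bullet> \<rho> w y = x \<bullet> y"
  and \<rho>_root: "w \<in> carrier W \<Longrightarrow> a \<in> \<Phi> \<Longrightarrow> \<rho> w a \<in> \<Phi>"
  using reflection_group_props \<rho>_carrier unfolding carrier_reflection_group by blast+

lemma \<rho>_mult:
  assumes "w \<in> carrier W" "x \<in> carrier W"
  shows "\<rho> (w \<otimes> x) v = \<rho> w (\<rho> x v)"
proof -
  have "\<rho> (w \<otimes> x) = \<rho> w \<otimes>\<^bsub>reflection_group \<Phi>\<^esub> \<rho> x"
    using iso assms by (auto simp: iso_def hom_def)
  also have "\<dots> = \<rho> w \<circ> \<rho> x"
    using BijGroup_mult[OF reflection_group_Bij reflection_group_Bij, OF \<rho>_carrier \<rho>_carrier, OF assms]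
    by (simp add: reflection_group_def)
  finally show ?thesis by simp
qed

lemma \<rho>_eqI:
  assumes "w \<in> carrier W" "x \<in> carrier W" "\<And>v. \<rho> w v = \<rho> x v"
  shows "w = x"
proof -
  have "inj_on \<rho> (carrier W)"
    using iso by (auto simp: iso_def bij_betw_def)
  with assms show ?thesis
    by (auto simp: inj_on_def fun_eq_iff)
qed

lemma \<rho>_one [simp]: "\<rho> \<one> v = v"
proof -
  have "bij (\<rho> \<one>)"
    using reflection_group_Bij \<rho>_carrier by simp
  moreover have "\<rho> \<one> (\<rho> \<one> v) = \<rho> \<one> v"
    using \<rho>_mult[of \<one> \<one>] by simp
  ultimately show ?thesis
    \<comment> \<open>An injective idempotent map is the identity.\<close>
    by (metis bij_pointE)
qed

lemma \<rho>_inv [simp]: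
  "w \<in> carrier W \<Longrightarrow> \<rho> (inv w) (\<rho> w v) = v" "w \<in> carrier W \<Longrightarrow> \<rho> w (\<rho> (inv w) v) = v"
  by (metis \<rho>_mult inv_closed l_inv \<rho>_one) (metis \<rho>_mult inv_closed r_inv \<rho>_one)

lemma \<rho>_adjoint:
  assumes "w \<in> carrier W"
  shows "x \<bullet> \<rho> w y = \<rho> (inv w) x \<bullet> y" "\<rho> w x \<bullet> y = x \<bullet> \<rho> (inv w) y"
  using \<rho>_inner[OF assms] \<rho>_inv(2)[OF assms] by metis+

section \<open>Reflections as elements of \<open>W\<close>\<close>

definition refl :: "'v \<Rightarrow> 'w" where
  "refl a = inv_into (carrier W) \<rho> (reflection a)"

text \<open>The image of \<open>\<rho>\<close> is generated by the reflections in roots, so for a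
  root the preimage chosen by \<open>refl\<close> exists.\<close>

lemma refl_closed: "a \<in> \<Phi> \<Longrightarrow> refl a \<in> carrier W"
  and \<rho>_refl: "a \<in> \<Phi> \<Longrightarrow> \<rho> (refl a) = reflection a"
proof -
  have *: "\<rho> ` carrier W = generate (BijGroup UNIV) (reflection ` \<Phi>)"
    using iso by (auto simp: iso_def bij_betw_def carrier_reflection_group)
  assume "a \<in> \<Phi>"
  then have "reflection a \<in> \<rho> ` carrier W"
    unfolding * by (intro generate.incl) simp
  then show "refl a \<in> carrier W" "\<rho> (refl a) = reflection a"
    unfolding refl_def by (auto intro: inv_into_into f_inv_into_f)
qed

lemma refl_conjugate:
  assumes "w \<in> carrier W" "a \<in> \<Phi>"
  shows "w \<otimes> refl a \<otimes> inv w = refl (\<rho> w a)"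
proof (rule \<rho>_eqI)
  fix v
  have "\<rho> (w \<otimes> refl a \<otimes> inv w) v = \<rho> w (reflection a (\<rho> (inv w) v))"
    using assms by (simp add: \<rho>_mult refl_closed \<rho>_refl)
  also have "\<dots> = reflection (\<rho> w a) v"
    using assms reflection_conjugate[OF \<rho>_linear[OF assms(1)] \<rho>_inner[OF assms(1)]] by simp
  finally show "\<rho> (w \<otimes> refl a \<otimes> inv w) v = \<rho> (refl (\<rho> w a)) v"
    using assms by (simp add: \<rho>_refl \<rho>_root)
qed (use assms in \<open>auto simp: refl_closed \<rho>_root\<close>)

lemma refl_eq_iff:
  assumes "a \<in> \<Phi>" "b \<in> \<Phi>"
  shows "refl a = refl b \<longleftrightarrow> a = b \<or> a = - b"
proof
  assume "refl a = refl b"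
  then have "reflection a = reflection b"
    using assms \<rho>_refl by metis
  then show "a = b \<or> a = - b"
    using reflection_eq_imp_span root_span assms zero_notin_\<Phi> by metis
next
  assume "a = b \<or> a = - b"
  moreover have "reflection (- b) = reflection b"
    by (auto simp: reflection_def fun_eq_iff)
  ultimately show "refl a = refl b"
    by (auto simp: refl_def)
qed

lemma refl_refl: "a \<in> \<Phi> \<Longrightarrow> refl a \<otimes> refl a = \<one>"
  by (rule \<rho>_eqI) (auto simp: \<rho>_mult refl_closed \<rho>_refl reflection_reflection)

lemma refl_inv: "a \<in> \<Phi> \<Longrightarrow> inv (refl a) = refl a"
  by (simp add: inv_equality refl_closed refl_refl)

text \<open>Injectivity of \<open>\<rho>\<close> carries the matching of generators with simple
  reflections back to \<open>W\<close>; subsets of \<open>S\<close> can then be replaced by subsets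
  of \<open>\<Delta>\<close>.\<close>

lemma S_eq: "S = refl ` \<Delta>"
proof -
  have *: "refl a = s" if "s \<in> S" "a \<in> \<Delta>" "\<rho> s = reflection a" for a s
    using that S_sub \<Delta>_sub by (intro \<rho>_eqI) (auto simp: refl_closed \<rho>_refl)
  show ?thesis
  proof (intro equalityI subsetI)
    fix s assume "s \<in> S"
    moreover from this obtain a where "a \<in> \<Delta>" "\<rho> s = reflection a"
      using \<rho>_S by blast
    ultimately show "s \<in> refl ` \<Delta>"
      using * by blast
  next
    fix s assume "s \<in> refl ` \<Delta>"
    then obtain a where a: "a \<in> \<Delta>" "s = refl a"
      by blast
    then have "reflection a \<in> \<rho> ` S"
      unfolding \<rho>_S by blast
    then obtain s' where "s' \<in> S" "\<rho> s' = reflection a"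
      by auto
    with a * show "s \<in> S"
      by blast
  qed
qed

section \<open>Positive roots and simple reflections\<close>

lemma positive_root_cone:
  assumes "b \<in> \<Phi>" "h \<bullet> b > 0"
  shows "\<exists>c. (\<forall>a\<in>\<Delta>. c a \<ge> 0) \<and> b = (\<Sum>a\<in>\<Delta>. c a *\<^sub>R a)"
proof -
  obtain c where c: "b = (\<Sum>a\<in>\<Delta>. c a *\<^sub>R a)" "(\<forall>a\<in>\<Delta>. c a \<ge> 0) \<or> (\<forall>a\<in>\<Delta>. c a \<le> 0)"
    using simple assms(1) by (auto simp: simple_roots_def)
  \<comment> \<open>The height of \<open>b\<close> is the sum of its coefficients, so its sign
    selects one of the two alternatives.\<close>
  have "h \<bullet> b = (\<Sum>a\<in>\<Delta>. c a)"
    unfolding c(1) by (simp add: inner_sum_right h_simple)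
  with assms(2) have "\<not> (\<forall>a\<in>\<Delta>. c a \<le> 0)"
    using sum_nonpos[of \<Delta> c] by auto
  with c show ?thesis by blast
qed

lemma root_not_orthogonal_h:
  assumes "b \<in> \<Phi>"
  shows "h \<bullet> b \<noteq> 0"
proof
  assume 0: "h \<bullet> b = 0"
  obtain c where c: "b = (\<Sum>a\<in>\<Delta>. c a *\<^sub>R a)" "(\<forall>a\<in>\<Delta>. c a \<ge> 0) \<or> (\<forall>a\<in>\<Delta>. c a \<le> 0)"
    using simple assms(1) by (auto simp: simple_roots_def)
  have sum0: "(\<Sum>a\<in>\<Delta>. c a) = 0"
    using 0 unfolding c(1) by (simp add: inner_sum_right h_simple)
  have "\<forall>a\<in>\<Delta>. c a = 0"
    using c(2)
  proof
    assume "\<forall>a\<in>\<Delta>. c a \<ge> 0"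
    with sum0 show ?thesis
      using sum_nonneg_eq_0_iff[OF finite_\<Delta>, of c] by blast
  next
    assume "\<forall>a\<in>\<Delta>. c a \<le> 0"
    with sum0 show ?thesis
      using sum_nonneg_eq_0_iff[OF finite_\<Delta>, of "\<lambda>a. - c a"] by (simp add: sum_negf)
  qed
  then have "b = 0"
    using c(1) by simp
  with assms zero_notin_\<Phi> show False by simp
qed

text \<open>By independence of \<open>\<Delta>\<close> the expansion in \<open>D\<close> agrees with
  the nonnegative expansion in \<open>\<Delta>\<close>.\<close>

lemma positive_root_cone_span:
  assumes b: "b \<in> \<Phi>" "h \<bullet> b > 0" and D: "D \<subseteq> \<Delta>" "b \<in> span D"
  shows "\<exists>c. (\<forall>a\<in>D. c a \<ge> 0) \<and> b = (\<Sum>a\<in>D. c a *\<^sub>R a)"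
proof -
  obtain c where c: "\<forall>a\<in>\<Delta>. c a \<ge> 0" "b = (\<Sum>a\<in>\<Delta>. c a *\<^sub>R a)"
    using positive_root_cone b by blast
  obtain d where d: "b = (\<Sum>a\<in>D. d a *\<^sub>R a)"
    using D finite_subset[OF D(1) finite_\<Delta>] by (auto simp: span_finite)
  have "b = (\<Sum>a\<in>\<Delta>. (if a \<in> D then d a else 0) *\<^sub>R a)"
    unfolding d by (rule sum.mono_neutral_cong_left) (use D finite_\<Delta> in auto)
  then have eq: "c a = (if a \<in> D then d a else 0)" if "a \<in> \<Delta>" for a
    using independent_coeffs_eq[OF indep_\<Delta> finite_\<Delta> _ that, of c "\<lambda>a. if a \<in> D then d a else 0"]
      c(2) by simp
  have "d a \<ge> 0" if "a \<in> D" for a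
    using eq[of a] c(1) subsetD[OF D(1) that] that by metis
  with d show ?thesis by blast
qed

text \<open>Otherwise \<open>r = - reflection a b\<close> is positive and \<open>r + b\<close> is a
  multiple of \<open>a\<close>. Nonnegative coefficients cannot cancel, so \<open>b\<close> is a
  multiple of \<open>a\<close>, hence \<open>a\<close> or \<open>- a\<close>.\<close>

lemma reflection_simple_positive:
  assumes a: "a \<in> \<Delta>" and b: "b \<in> \<Phi>" "h \<bullet> b > 0" "b \<noteq> a"
  shows "h \<bullet> reflection a b > 0"
proof (rule ccontr)
  assume neg: "\<not> h \<bullet> reflection a b > 0"
  define r where "r = - reflection a b"
  have r: "r \<in> \<Phi>" "h \<bullet> r > 0"
    using neg root_not_orthogonal_h[of "reflection a b"] reflection_root[of a b] a b \<Delta>_sub root_neg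
    by (auto simp: r_def)
  obtain c where c: "\<forall>a\<in>\<Delta>. c a \<ge> 0" "b = (\<Sum>a\<in>\<Delta>. c a *\<^sub>R a)"
    using positive_root_cone b by blast
  obtain d where d: "\<forall>a\<in>\<Delta>. d a \<ge> 0" "r = (\<Sum>a\<in>\<Delta>. d a *\<^sub>R a)"
    using positive_root_cone r by blast
  obtain k where k: "r + b = k *\<^sub>R a"
    by (auto simp: r_def reflection_def)
  have "(\<Sum>x\<in>\<Delta>. (d x + c x) *\<^sub>R x) = (\<Sum>x\<in>\<Delta>. (if x = a then k else 0) *\<^sub>R x)"
    using k a finite_\<Delta> unfolding c(2) d(2)
    by (simp add: scaleR_add_left sum.distrib if_distrib[of "\<lambda>k. k *\<^sub>R _"] cong: if_cong)
  then have sum_eq: "d x + c x = (if x = a then k else 0)" if "x \<in> \<Delta>" for x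
    using independent_coeffs_eq[OF indep_\<Delta> finite_\<Delta> _ that,
        of "\<lambda>x. d x + c x" "\<lambda>x. if x = a then k else 0"] by simp
  have "c x = 0" if "x \<in> \<Delta>" "x \<noteq> a" for x
  proof -
    have "c x \<ge> 0" "d x \<ge> 0" "d x + c x = 0"
      using that c(1) d(1) sum_eq[of x] by auto
    then show ?thesis by linarith
  qed
  then have "b = (\<Sum>x\<in>\<Delta>. (if x = a then c a else 0) *\<^sub>R x)"
    unfolding c(2) by (intro sum.cong) auto
  then have "b = c a *\<^sub>R a"
    using a finite_\<Delta> by (simp add: if_distrib[of "\<lambda>k. k *\<^sub>R _"] sum.delta cong: if_cong)
  then have "b \<in> span {a}"
    by (metis span_base span_scale singletonI)
  then have "b = - a"
    using root_span b a \<Delta>_sub by blast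
  with b(2) h_simple[OF a] show False by simp
qed

section \<open>Length and positivity\<close>

abbreviation len :: "'w \<Rightarrow> nat" where
  "len \<equiv> cox_length W S"

lemma word_prod_closed [simp]: "u \<in> lists S \<Longrightarrow> word_prod W u \<in> carrier W"
  by (induction u) (use S_sub in auto)

lemma word_prod_append:
  "u \<in> lists S \<Longrightarrow> v \<in> lists S \<Longrightarrow> word_prod W (u @ v) = word_prod W u \<otimes> word_prod W v"
proof (induction u)
  case (Cons s u)
  then have "s \<in> carrier W" "u \<in> lists S"
    using S_sub by auto
  with Cons show ?case
    by (simp add: m_assoc)
qed simp

lemma word_prod_rev: "u \<in> lists S \<Longrightarrow> word_prod W (rev u) = inv (word_prod W u)"
proof (induction u)
  case (Cons s u)
  then have s: "s \<in> carrier W" "inv s = s" "s \<in> S" "u \<in> lists S"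
    using S_sub S_sq[of s] by (auto intro: inv_equality)
  moreover have "rev u \<in> lists S"
    using s(4) by auto
  ultimately show ?case
    using Cons.IH by (simp add: word_prod_append inv_mult_group)
qed simp

lemma ex_word:
  assumes "w \<in> carrier W"
  shows "\<exists>u\<in>lists S. word_prod W u = w"
proof -
  have "w \<in> generate W S"
    using assms generate_S by simp
  then show ?thesis
  proof induction
    case one
    show ?case
      by (rule bexI[of _ "[]"]) auto
  next
    case (incl s)
    then show ?case
      using S_sub by (intro bexI[of _ "[s]"]) auto
  next
    case (inv s)
    then have "inv s = s"
      using S_sub S_sq[of s] by (auto intro: inv_equality)
    with inv show ?case
      using S_sub by (intro bexI[of _ "[s]"]) auto
  next
    case (eng x y)
    then obtain u v where "u \<in> lists S" "v \<in> lists S" "word_prod W u = x" "word_prod W v = y"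
      by blast
    then show ?case
      by (intro bexI[of _ "u @ v"]) (auto simp: word_prod_append)
  qed
qed

lemma reduced_word:
  assumes "w \<in> carrier W"
  shows "\<exists>u\<in>lists S. word_prod W u = w \<and> length u = len w"
proof -
  obtain u where "u \<in> lists S" "word_prod W u = w"
    using ex_word assms by blast
  then have "\<exists>u'\<in>lists S. length u' = length u \<and> word_prod W u' = w"
    by blast
  from LeastI[of "\<lambda>n. \<exists>u\<in>lists S. length u = n \<and> word_prod W u = w", OF this]
  show ?thesis
    unfolding cox_length_def by blast
qed

lemma len_le: "u \<in> lists S \<Longrightarrow> len (word_prod W u) \<le> length u"
  unfolding cox_length_def by (rule Least_le) blast

lemma len_inv_le: "w \<in> carrier W \<Longrightarrow> len (inv w) \<le> len w"
  using reduced_word[of w] len_le[of "rev _"] word_prod_rev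
  by (metis in_lists_conv_set length_rev set_rev)

lemma len_inv: "w \<in> carrier W \<Longrightarrow> len (inv w) = len w"
  using len_inv_le[of w] len_inv_le[of "inv w"] by simp

text \<open>Exchange condition. As the letters act from the right, \<open>a\<close> turns negative
  at some letter \<open>t\<close>. Just before, it equals the simple root of \<open>t\<close>, so
  the remaining suffix conjugates \<open>refl a\<close> to \<open>t\<close> and the two copies of
  \<open>t\<close> cancel.\<close>

lemma exchange:
  assumes "u \<in> lists S" "a \<in> \<Delta>" "h \<bullet> \<rho> (word_prod W u) a < 0"
  shows "\<exists>u'\<in>lists S. Suc (length u') = length u \<and> word_prod W u' = word_prod W u \<otimes> refl a"
  using assms(1,3)
proof (induction u)
  case Nil
  then show ?case
    using h_simple[OF assms(2)] by simp
next
  case (Cons t u)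
  have a: "a \<in> \<Phi>" and w: "word_prod W u \<in> carrier W"
    using assms(2) \<Delta>_sub Cons by auto
  obtain b where b: "b \<in> \<Delta>" "t = refl b"
    using Cons S_eq by auto
  then have "b \<in> \<Phi>"
    using \<Delta>_sub by blast
  show ?case
  proof (cases "h \<bullet> \<rho> (word_prod W u) a < 0")
    case True
    then obtain u' where "u' \<in> lists S" "Suc (length u') = length u"
      "word_prod W u' = word_prod W u \<otimes> refl a"
      using Cons by auto
    then show ?thesis
      using Cons w a b \<open>b \<in> \<Phi>\<close> by (intro bexI[of _ "t # u'"]) (auto simp: m_assoc refl_closed)
  next
    case False
    then have "h \<bullet> \<rho> (word_prod W u) a > 0"
      using root_not_orthogonal_h \<rho>_root[OF w a] by (metis linorder_neqE_linordered_idom)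
    moreover have "\<not> h \<bullet> reflection b (\<rho> (word_prod W u) a) > 0"
      using Cons.prems b \<open>b \<in> \<Phi>\<close> w by (simp add: \<rho>_mult refl_closed \<rho>_refl)
    ultimately have "\<rho> (word_prod W u) a = b"
      using reflection_simple_positive[OF b(1) \<rho>_root[OF w a]] by blast
    then have "word_prod W u \<otimes> refl a \<otimes> inv (word_prod W u) = t"
      using refl_conjugate[OF w a] b by simp
    then have "word_prod W u \<otimes> refl a = t \<otimes> word_prod W u"
      using w a by (metis inv_solve_right refl_closed m_closed b(2) \<open>b \<in> \<Phi>\<close>)
    then have "word_prod W (t # u) \<otimes> refl a = t \<otimes> (t \<otimes> word_prod W u)"
      using w a b \<open>b \<in> \<Phi>\<close> by (simp add: m_assoc refl_closed)
    also have "\<dots> = word_prod W u"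
      using w b \<open>b \<in> \<Phi>\<close> by (simp add: m_assoc[symmetric] refl_closed refl_refl)
    finally show ?thesis
      using Cons by (intro bexI[of _ u]) auto
  qed
qed

lemma len_mult_simple_less:
  assumes w: "w \<in> carrier W" and a: "a \<in> \<Delta>" and "h \<bullet> \<rho> w a < 0"
  shows "len (w \<otimes> refl a) < len w"
proof -
  obtain u where u: "u \<in> lists S" "word_prod W u = w" "length u = len w"
    using reduced_word w by blast
  then obtain u' where "u' \<in> lists S" "Suc (length u') = length u" "word_prod W u' = w \<otimes> refl a"
    using exchange[of u a] assms by auto
  then show ?thesis
    using len_le[of u'] u by simp
qed

text \<open>The positive case is the negative case for \<open>w \<otimes> refl a\<close>, which
  sends \<open>a\<close> to \<open>- \<rho> w a\<close>.\<close>

lemma len_mult_simple_iff: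
  assumes w: "w \<in> carrier W" and a: "a \<in> \<Delta>"
  shows "len (w \<otimes> refl a) > len w \<longleftrightarrow> h \<bullet> \<rho> w a > 0"
proof -
  have a': "a \<in> \<Phi>" "refl a \<in> carrier W" "a \<noteq> 0"
    using a \<Delta>_sub refl_closed zero_notin_\<Phi> by auto
  have *: "h \<bullet> \<rho> w a \<noteq> 0"
    using root_not_orthogonal_h \<rho>_root w a' by blast
  have "len w < len (w \<otimes> refl a)" if "h \<bullet> \<rho> w a > 0"
  proof -
    have "\<rho> (w \<otimes> refl a) a = - \<rho> w a"
      using w a' by (simp add: \<rho>_mult \<rho>_refl reflection_self linear_neg[OF \<rho>_linear])
    then have "len (w \<otimes> refl a \<otimes> refl a) < len (w \<otimes> refl a)"
      using that w a a' by (intro len_mult_simple_less) auto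
    then show ?thesis
      using w a' by (simp add: m_assoc refl_refl)
  qed
  moreover have "len (w \<otimes> refl a) < len w" if "h \<bullet> \<rho> w a < 0"
    using len_mult_simple_less assms that by blast
  ultimately show ?thesis
    using * by (meson linorder_neqE_linordered_idom not_less_iff_gr_or_eq)
qed

lemma len_simple_mult_iff:
  assumes w: "w \<in> carrier W" and a: "a \<in> \<Delta>"
  shows "len (refl a \<otimes> w) > len w \<longleftrightarrow> h \<bullet> \<rho> (inv w) a > 0"
proof -
  have a': "a \<in> \<Phi>" "refl a \<in> carrier W"
    using a \<Delta>_sub refl_closed by auto
  have "refl a \<otimes> w = inv (inv w \<otimes> refl a)"
    using w a' by (simp add: inv_mult_group refl_inv)
  then have "len (refl a \<otimes> w) = len (inv w \<otimes> refl a)"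
    using w a' by (simp add: len_inv)
  then show ?thesis
    using len_mult_simple_iff[of "inv w" a] w a by (simp add: len_inv)
qed

section \<open>Free action on chambers\<close>

lemma eq_one_if_simple_positive:
  assumes w: "w \<in> carrier W" and pos: "\<And>a. a \<in> \<Delta> \<Longrightarrow> h \<bullet> \<rho> w a > 0"
  shows "w = \<one>"
proof (rule ccontr)
  assume "w \<noteq> \<one>"
  obtain u where u: "u \<in> lists S" "word_prod W u = w" "length u = len w"
    using reduced_word w by blast
  with \<open>w \<noteq> \<one>\<close> have "u \<noteq> []"
    by auto
  then obtain v s where v: "u = v @ [s]"
    by (metis rev_exhaust)
  with u S_eq obtain a where a: "a \<in> \<Delta>" "s = refl a" and vS: "v \<in> lists S"
    by auto
  then have a': "a \<in> \<Phi>" "refl a \<in> carrier W"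
    using \<Delta>_sub refl_closed by auto
  have "w = word_prod W v \<otimes> refl a"
    using u(1,2) v a a' vS by (subst u(2)[symmetric]) (simp add: word_prod_append)
  then have "w \<otimes> refl a = word_prod W v"
    using a' vS by (simp add: m_assoc refl_refl)
  \<comment> \<open>Cancelling the last letter of a reduced word shortens \<open>w\<close>, so
    \<open>w\<close> would send the simple root of that letter to a negative root.\<close>
  then have "len (w \<otimes> refl a) < len w"
    using len_le[OF vS] u v by simp
  with len_mult_simple_iff[OF w a(1)] pos[OF a(1)] show False
    by simp
qed

text \<open>Take \<open>g\<close> maximising \<open>p \<bullet> \<rho> g v\<close> and compare with \<open>refl b \<otimes> g\<close>.\<close>

lemma ex_folding:
  assumes G: "G \<subseteq> carrier W" "G \<noteq> {}" and B: "B \<subseteq> \<Phi>"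
    and closed: "\<And>b g. b \<in> B \<Longrightarrow> g \<in> G \<Longrightarrow> refl b \<otimes> g \<in> G"
  shows "\<exists>g\<in>G. \<forall>b\<in>B. (p \<bullet> b) * (\<rho> g v \<bullet> b) \<ge> 0"
proof -
  have fin: "finite ((\<lambda>g. p \<bullet> \<rho> g v) ` G)" "(\<lambda>g. p \<bullet> \<rho> g v) ` G \<noteq> {}"
    using G finite_subset[OF G(1) finite_W] by auto
  obtain g where g: "g \<in> G" "\<And>g'. g' \<in> G \<Longrightarrow> p \<bullet> \<rho> g' v \<le> p \<bullet> \<rho> g v"
  proof -
    obtain g where "g \<in> G" "Max ((\<lambda>g. p \<bullet> \<rho> g v) ` G) = p \<bullet> \<rho> g v"
      using Max_in[OF fin] by blast
    with Max_ge[OF fin(1)] that show thesis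
      by (metis imageI)
  qed
  have "(p \<bullet> b) * (\<rho> g v \<bullet> b) \<ge> 0" if "b \<in> B" for b
  proof -
    have b: "b \<in> \<Phi>" "b \<noteq> 0"
      using that B zero_notin_\<Phi> by auto
    have "p \<bullet> \<rho> (refl b \<otimes> g) v \<le> p \<bullet> \<rho> g v"
      using g(2)[OF closed[OF that g(1)]] .
    moreover have "\<rho> (refl b \<otimes> g) v = reflection b (\<rho> g v)"
      using b g(1) G(1) by (subst \<rho>_mult) (auto simp: refl_closed \<rho>_refl)
    ultimately have "0 \<le> 2 * (\<rho> g v \<bullet> b) / (b \<bullet> b) * (p \<bullet> b)"
      by (simp add: reflection_def inner_diff_right)
    then have "0 \<le> (p \<bullet> b) * (\<rho> g v \<bullet> b) * (2 / (b \<bullet> b))"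
      by (simp add: mult_ac)
    moreover have "2 / (b \<bullet> b) > 0"
      using b(2) by simp
    ultimately show ?thesis
      using zero_le_mult_iff linorder_not_less by blast
  qed
  with g(1) show ?thesis by blast
qed

text \<open>Some \<open>g\<close> folds \<open>v\<close> into the chamber of \<open>h\<close>. The
  conjugate of \<open>w\<close> by \<open>g\<close> then maps a point of that chamber into the
  chamber, hence sends simple roots to positive roots.\<close>

lemma eq_one_if_same_chamber:
  assumes w: "w \<in> carrier W" and same: "\<And>b. b \<in> \<Phi> \<Longrightarrow> (b \<bullet> v) * (b \<bullet> \<rho> w v) > 0"
  shows "w = \<one>"
proof -
  obtain g where g: "g \<in> carrier W" "\<forall>b\<in>\<Phi>. (h \<bullet> b) * (\<rho> g v \<bullet> b) \<ge> 0"
    using ex_folding[of "carrier W" \<Phi> h v] refl_closed by auto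
  \<comment> \<open>The hypothesis at the root \<open>\<rho> (inv g) b\<close> already says that it
    is not orthogonal to \<open>v\<close>.\<close>
  have nz: "b \<bullet> \<rho> g v \<noteq> 0" if "b \<in> \<Phi>" for b
    using same[OF \<rho>_root[OF inv_closed[OF g(1)] that]] by (auto simp: \<rho>_adjoint(1)[OF g(1)])
  have sgn: "(h \<bullet> b) * (b \<bullet> \<rho> g v) > 0" if "b \<in> \<Phi>" for b
    using g(2) that nz[OF that] root_not_orthogonal_h[OF that] 
    by (metis inner_commute less_eq_real_def mult_eq_0_iff)
  define w' where "w' = g \<otimes> w \<otimes> inv g"
  have w': "w' \<in> carrier W" "w' \<otimes> g = g \<otimes> w"
    using w g(1) by (auto simp: w'_def m_assoc)
  have "h \<bullet> \<rho> w' a > 0" if "a \<in> \<Delta>" for a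
  proof -
    have a: "a \<in> \<Phi>" "\<rho> w' a \<in> \<Phi>" "\<rho> (inv g) (\<rho> w' a) \<in> \<Phi>"
      using that \<Delta>_sub \<rho>_root w' g(1) by auto
    have "\<rho> w' a \<bullet> \<rho> g (\<rho> w v) = \<rho> w' a \<bullet> \<rho> w' (\<rho> g v)"
      using w w' g(1) by (metis \<rho>_mult)
    also have "\<dots> = a \<bullet> \<rho> g v"
      by (rule \<rho>_inner[OF w'(1)])
    finally have "\<rho> (inv g) (\<rho> w' a) \<bullet> \<rho> w v > 0"
      using sgn[OF a(1)] h_simple[OF that] by (simp add: \<rho>_adjoint(1)[OF g(1)])
    then have "\<rho> (inv g) (\<rho> w' a) \<bullet> v > 0"
      using same[OF a(3)] by (simp add: zero_less_mult_iff)
    then have "\<rho> w' a \<bullet> \<rho> g v > 0"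
      by (simp add: \<rho>_adjoint(1)[OF g(1)])
    then show ?thesis
      using sgn[OF a(2)] by (simp add: zero_less_mult_iff)
  qed
  then have "w' = \<one>"
    using eq_one_if_simple_positive w'(1) by blast
  then show ?thesis
    using w'(2) w g(1) r_cancel_one[of g w] by simp
qed

text \<open>Only the roots orthogonal to \<open>U\<close> have to be checked: for a generic
  \<open>g\<close> in \<open>U\<close> and large \<open>t\<close>, the fixed summand
  \<open>t *\<^sub>R g\<close> determines the signs at all other roots. This is the form in which
  freeness is applied below.\<close>

lemma eq_one_if_fixes_same_chamber:
  assumes w: "w \<in> carrier W" and U: "subspace U" and fixes_U: "\<And>v. v \<in> U \<Longrightarrow> \<rho> w v = v"
    and same: "\<And>b. b \<in> \<Phi> \<Longrightarrow> (\<And>u. u \<in> U \<Longrightarrow> b \<bullet> u = 0) \<Longrightarrow> (b \<bullet> p) * (b \<bullet> \<rho> w p) > 0"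
  shows "w = \<one>"
proof -
  have "\<exists>g\<in>U. \<forall>b\<in>{b\<in>\<Phi>. \<exists>u\<in>U. b \<bullet> u \<noteq> 0}. b \<bullet> g \<noteq> 0"
    by (rule nonvanishing_vector[OF _ U]) (use finite_\<Phi> in auto)
  then obtain g where g: "g \<in> U" "\<And>b. b \<in> \<Phi> \<Longrightarrow> \<exists>u\<in>U. b \<bullet> u \<noteq> 0 \<Longrightarrow> b \<bullet> g \<noteq> 0"
    by blast
  have "\<exists>t. \<forall>b\<in>\<Phi>. (b \<bullet> (p + t *\<^sub>R g)) * (b \<bullet> (\<rho> w p + t *\<^sub>R g)) > 0"
    by (rule eventually_same_sign[OF finite_\<Phi>]) (use g(2) same in blast)
  then obtain t where t: "\<forall>b\<in>\<Phi>. (b \<bullet> (p + t *\<^sub>R g)) * (b \<bullet> (\<rho> w p + t *\<^sub>R g)) > 0"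
    by blast
  have "\<rho> w (p + t *\<^sub>R g) = \<rho> w p + t *\<^sub>R g"
    using fixes_U[OF g(1)] by (simp add: linear_add linear_scale \<rho>_linear[OF w])
  with t show ?thesis
    by (intro eq_one_if_same_chamber[OF w, of "p + t *\<^sub>R g"]) auto
qed

text \<open>If \<open>e\<close> is proportional to no root, then no root is orthogonal to the whole
  hyperplane, so the chamber condition of the preceding lemma holds vacuously and forces
  \<open>w = \<one>\<close>.\<close>

lemma reflection_fixing_hyperplane:
  assumes w: "w \<in> carrier W" "w \<noteq> \<one>" and fixes_e: "\<And>v. v \<bullet> e = 0 \<Longrightarrow> \<rho> w v = v"
  shows "\<exists>b\<in>\<Phi>. \<exists>c. e = c *\<^sub>R b"
proof (rule ccontr)
  assume no: "\<not> ?thesis"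
  have "w = \<one>"
  proof (rule eq_one_if_fixes_same_chamber[OF w(1)])
    show "subspace {v. v \<bullet> e = 0}"
      by (auto simp: subspace_def inner_add_left)
    fix b assume b: "b \<in> \<Phi>" "\<And>u. u \<in> {v. v \<bullet> e = 0} \<Longrightarrow> b \<bullet> u = 0"
    \<comment> \<open>Up to the factor \<open>e \<bullet> e\<close>, this is the component of
      \<open>b\<close> orthogonal to \<open>e\<close>.\<close>
    define u where "u = (e \<bullet> e) *\<^sub>R b - (b \<bullet> e) *\<^sub>R e"
    have "b \<bullet> u = 0"
      by (rule b(2)) (simp add: u_def inner_diff_left)
    moreover have "e \<bullet> u = 0"
      by (simp add: u_def inner_diff_right inner_commute)
    ultimately have "u \<bullet> u = 0"
      by (simp add: u_def inner_diff_left)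
    then have "(e \<bullet> e) *\<^sub>R b = (b \<bullet> e) *\<^sub>R e"
      by (simp add: u_def)
    moreover have "b \<noteq> 0"
      using b zero_notin_\<Phi> by auto
    moreover have "e \<noteq> 0"
      using no b(1) by (metis scaleR_zero_left)
    ultimately have "b \<bullet> e \<noteq> 0"
      by auto
    then have "e = ((e \<bullet> e) / (b \<bullet> e)) *\<^sub>R b"
      using \<open>(e \<bullet> e) *\<^sub>R b = (b \<bullet> e) *\<^sub>R e\<close>
      by (metis (no_types, lifting) divide_inverse_commute left_inverse scaleR_one scaleR_scaleR)
    with no b(1) show "0 < b \<bullet> h * (b \<bullet> \<rho> w h)"
      by blast
  qed (use fixes_e in auto)
  with w(2) show False ..
qed

end

section \<open>Parabolic subgroups and their normalisers\<close>

locale parabolic = coxeter_rep W S \<Phi> \<Delta> \<rho> h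
  for W :: "('w, 'm) monoid_scheme" (structure) and S :: "'w set"
    and \<Phi> \<Delta> :: "'v::euclidean_space set" and \<rho> :: "'w \<Rightarrow> 'v \<Rightarrow> 'v" and h :: 'v +
  fixes D :: "'v set"
  assumes D_sub: "D \<subseteq> \<Delta>"
begin

abbreviation J :: "'w set" where
  "J \<equiv> refl ` D"

abbreviation WJ :: "'w set" where
  "WJ \<equiv> generate W J"

lemma D_simple: "a \<in> D \<Longrightarrow> a \<in> \<Delta>"
  and D_root: "a \<in> D \<Longrightarrow> a \<in> \<Phi>"
  and finite_D: "finite D"
  using D_sub \<Delta>_sub finite_\<Delta> finite_subset by auto

lemma J_carrier: "J \<subseteq> carrier W"
  using D_root refl_closed by blast

lemma WJ_carrier: "w \<in> WJ \<Longrightarrow> w \<in> carrier W"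
  using generate_in_carrier[OF J_carrier] .

lemma WJ_subgroup: "subgroup WJ W"
  using generate_is_subgroup[OF J_carrier] .

lemma refl_WJ: "a \<in> D \<Longrightarrow> refl a \<in> WJ"
  by (rule generate.incl) simp

lemma WJ_fixes_perp:
  assumes "w \<in> WJ" and perp: "\<And>a. a \<in> D \<Longrightarrow> v \<bullet> a = 0"
  shows "\<rho> w v = v"
  using assms(1)
proof induction
  case (incl s)
  then show ?case
    using perp by (auto simp: \<rho>_refl D_root reflection_fixes)
next
  case (inv s)
  then show ?case
    using perp by (auto simp: refl_inv \<rho>_refl D_root reflection_fixes)
next
  case (eng x y)
  then show ?case
    by (simp add: \<rho>_mult WJ_carrier)
qed simp

text \<open>The inverse of \<open>w\<close> fixes every vector orthogonal to \<open>D\<close>, so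
  \<open>\<rho> w x\<close> stays orthogonal to all of these.\<close>

lemma WJ_span:
  assumes "w \<in> WJ" "x \<in> span D"
  shows "\<rho> w x \<in> span D"
proof (rule in_span_if_perp_perp)
  fix u assume u: "\<And>a. a \<in> D \<Longrightarrow> u \<bullet> a = 0"
  have "inv w \<in> WJ"
    using WJ_subgroup assms(1) by (simp add: subgroup.m_inv_closed)
  then show "\<rho> w x \<bullet> u = 0"
    using WJ_fixes_perp[OF _ u, of "inv w"] perp_span[OF assms(2) u] WJ_carrier[OF assms(1)]
    by (simp add: \<rho>_adjoint(2)[of w] inner_commute[of x])
qed

text \<open>A positive root in \<open>span D\<close> is a nonnegative combination of
  \<open>D\<close>; a negative one is replaced by its negative. Chambers for the roots in
  \<open>span D\<close> can thus be compared on \<open>D\<close> alone.\<close>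

lemma sign_on_span_D:
  assumes b: "b \<in> \<Phi>" "b \<in> span D" and x: "\<And>a. a \<in> D \<Longrightarrow> a \<bullet> x \<ge> 0" "b \<bullet> x \<noteq> 0"
  shows "(b \<bullet> h) * (b \<bullet> x) > 0"
proof -
  have pos: "(c \<bullet> h) * (c \<bullet> x) > 0" if c: "c \<in> \<Phi>" "c \<in> span D" "h \<bullet> c > 0" "c \<bullet> x \<noteq> 0" for c
  proof -
    obtain k where k: "\<forall>a\<in>D. k a \<ge> 0" "c = (\<Sum>a\<in>D. k a *\<^sub>R a)"
      using positive_root_cone_span[OF c(1,3) _ c(2)] D_simple by blast
    have "c \<bullet> x = (\<Sum>a\<in>D. k a * (a \<bullet> x))"
      by (subst k(2)) (simp add: inner_sum_left)
    also have "\<dots> \<ge> 0"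
      using k(1) x(1) by (intro sum_nonneg) simp
    finally show ?thesis
      using c(3,4) by (simp add: inner_commute zero_less_mult_iff)
  qed
  show ?thesis
  proof (cases "h \<bullet> b > 0")
    case True
    then show ?thesis
      using pos[of b] b x(2) by simp
  next
    case False
    then have "h \<bullet> (- b) > 0"
      using root_not_orthogonal_h[OF b(1)] by simp
    then show ?thesis
      using pos[of "- b"] b x(2) by (simp add: root_neg span_neg)
  qed
qed

text \<open>Fold \<open>\<rho> w h\<close> by some \<open>u\<close> in \<open>WJ\<close> to the
  nonnegative side of \<open>D\<close>. Then \<open>u \<otimes> w\<close> fixes the complement of
  \<open>span D\<close> and keeps \<open>h\<close> in its chamber for the roots in
  \<open>span D\<close>, so it is trivial.\<close>

lemma in_WJ_if_fixes_perp:
  assumes w: "w \<in> carrier W" and perp: "\<And>v. (\<And>a. a \<in> D \<Longrightarrow> v \<bullet> a = 0) \<Longrightarrow> \<rho> w v = v"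
  shows "w \<in> WJ"
proof -
  have "\<exists>u\<in>WJ. \<forall>b\<in>D. (h \<bullet> b) * (\<rho> u (\<rho> w h) \<bullet> b) \<ge> 0"
    by (rule ex_folding)
      (auto simp: WJ_carrier D_root intro: generate.one subgroup.m_closed[OF WJ_subgroup] refl_WJ)
  then obtain u where u: "u \<in> WJ" "\<And>b. b \<in> D \<Longrightarrow> \<rho> u (\<rho> w h) \<bullet> b \<ge> 0"
    using h_simple D_simple by (metis mult_1)
  have uc: "u \<in> carrier W"
    using u WJ_carrier by blast
  have "u \<otimes> w = \<one>"
  proof (rule eq_one_if_fixes_same_chamber[where U = "{v. \<forall>a\<in>D. v \<bullet> a = 0}" and p = h])
    show "subspace {v. \<forall>a\<in>D. v \<bullet> a = 0}"
      by (auto simp: subspace_def inner_add_left)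
    show "\<rho> (u \<otimes> w) v = v" if "v \<in> {v. \<forall>a\<in>D. v \<bullet> a = 0}" for v
      using that perp WJ_fixes_perp[OF u(1)] w uc by (simp add: \<rho>_mult)
    fix b assume b: "b \<in> \<Phi>" "\<And>v. v \<in> {v. \<forall>a\<in>D. v \<bullet> a = 0} \<Longrightarrow> b \<bullet> v = 0"
    have "b \<in> span D"
      by (rule in_span_if_perp_perp) (use b(2) in blast)
    moreover have "b \<bullet> \<rho> (u \<otimes> w) h \<noteq> 0"
      using root_not_orthogonal_h[OF \<rho>_root[of "inv (u \<otimes> w)" b]] b(1) uc w
      by (simp add: \<rho>_adjoint(1)[of "u \<otimes> w"] inner_commute)
    ultimately show "b \<bullet> h * (b \<bullet> \<rho> (u \<otimes> w) h) > 0"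
      using b(1) u(2) uc w by (intro sign_on_span_D) (simp_all add: \<rho>_mult inner_commute)
  qed (use uc w in simp)
  then have "w = inv u"
    using uc w by (metis inv_equality inv_inv inv_closed)
  then show ?thesis
    using WJ_subgroup u(1) by (simp add: subgroup.m_inv_closed)
qed

section \<open>The complement \<open>N_set\<close> and the normaliser\<close>

lemma conjugate_set:
  assumes "w \<in> carrier W" "H \<subseteq> carrier W"
  shows "w <# H #> inv w = (\<lambda>g. w \<otimes> g \<otimes> inv w) ` H"
  by (auto simp: l_coset_def r_coset_def)

lemma conjugate_J:
  assumes "w \<in> carrier W"
  shows "w <# J #> inv w = refl ` \<rho> w ` D"
  using assms refl_conjugate[OF assms] D_root
  by (subst conjugate_set[OF assms J_carrier]) (auto simp: image_image)

lemma \<rho>_inj: "w \<in> carrier W \<Longrightarrow> inj_on (\<rho> w) A"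
  by (rule inj_on_inverseI[of _ "\<rho> (inv w)"]) simp

lemma D_set_iff:
  "x \<in> D_set W S J \<longleftrightarrow> x \<in> carrier W \<and> (\<forall>a\<in>D. h \<bullet> \<rho> x a > 0 \<and> h \<bullet> \<rho> (inv x) a > 0)"
  unfolding D_set_def
  using len_mult_simple_iff len_simple_mult_iff D_simple by auto

lemma permutes_D_inv:
  assumes "x \<in> carrier W" "\<rho> x ` D = D"
  shows "\<rho> (inv x) ` D = D"
proof -
  have "\<rho> (inv x) ` \<rho> x ` D = D"
    using assms(1) by (simp add: image_image)
  with assms(2) show ?thesis by simp
qed

text \<open>Conjugation permutes the reflections in \<open>D\<close>, hence \<open>D\<close> up to
  signs; the length conditions of \<open>D_set\<close> exclude the sign change.\<close>

lemma N_set_iff: "x \<in> N_set W S J \<longleftrightarrow> x \<in> carrier W \<and> \<rho> x ` D = D"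
proof
  assume x: "x \<in> N_set W S J"
  then have xc: "x \<in> carrier W" and pos: "\<And>a. a \<in> D \<Longrightarrow> h \<bullet> \<rho> (inv x) a > 0"
    by (auto simp: N_set_def D_set_iff)
  have "refl ` \<rho> (inv x) ` D = J"
    using x xc conjugate_J[of "inv x"] by (simp add: N_set_def)
  then have *: "\<exists>b\<in>D. refl (\<rho> (inv x) a) = refl b" if "a \<in> D" for a
    using that by blast
  have "\<rho> (inv x) ` D \<subseteq> D"
  proof
    fix y assume "y \<in> \<rho> (inv x) ` D"
    then obtain a where a: "a \<in> D" "y = \<rho> (inv x) a"
      by blast
    then obtain b where b: "b \<in> D" "refl y = refl b"
      using * by blast
    then have "y = b \<or> y = - b"
      using a xc by (subst (asm) refl_eq_iff) (auto simp: D_root \<rho>_root)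
    moreover have "y \<noteq> - b"
      using pos[OF a(1)] h_simple[OF D_simple[OF b(1)]] a(2) by auto
    ultimately show "y \<in> D"
      using b by simp
  qed
  then have "\<rho> (inv x) ` D = D"
    using endo_inj_surj[OF finite_D _ \<rho>_inj] xc by simp
  then have "\<rho> (inv (inv x)) ` D = D"
    using permutes_D_inv xc by blast
  with xc show "x \<in> carrier W \<and> \<rho> x ` D = D"
    by simp
next
  assume "x \<in> carrier W \<and> \<rho> x ` D = D"
  then have x: "x \<in> carrier W" "\<rho> x ` D = D" "\<rho> (inv x) ` D = D"
    using permutes_D_inv by auto
  have "h \<bullet> \<rho> x a > 0" "h \<bullet> \<rho> (inv x) a > 0" if "a \<in> D" for a
    using x that h_simple[of "\<rho> x a"] h_simple[of "\<rho> (inv x) a"] D_simple by fastforce+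
  moreover have "inv x <# J #> x = J"
    using conjugate_J[of "inv x"] x by simp
  ultimately show "x \<in> N_set W S J"
    using x by (auto simp: N_set_def D_set_iff)
qed

text \<open>If \<open>y\<close> normalises \<open>WJ\<close>, the reflection in
  \<open>\<rho> y a\<close> lies in \<open>WJ\<close> and fixes the complement of
  \<open>span D\<close>, which puts \<open>\<rho> y a\<close> in \<open>span D\<close>. Conversely,
  conjugates of elements of \<open>WJ\<close> fix that complement and so lie in
  \<open>WJ\<close>.\<close>

lemma normalizer_iff:
  "y \<in> normalizer W WJ \<longleftrightarrow> y \<in> carrier W \<and> (\<forall>a\<in>D. \<rho> y a \<in> span D)"
proof -
  have sub: "WJ \<subseteq> carrier W"
    using WJ_carrier by blast
  have "y \<in> normalizer W WJ \<longleftrightarrow> y \<in> carrier W \<and> (\<lambda>g. y \<otimes> g \<otimes> inv y) ` WJ = WJ"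
    using conjugate_set[OF _ sub, of y] sub by (auto simp: normalizer_def stabilizer_def)
  also have "\<dots> \<longleftrightarrow> y \<in> carrier W \<and> (\<forall>a\<in>D. \<rho> y a \<in> span D)"
  proof (intro conj_cong refl iffI ballI)
    fix a assume y: "y \<in> carrier W" and eq: "(\<lambda>g. y \<otimes> g \<otimes> inv y) ` WJ = WJ" and a: "a \<in> D"
    then have r: "refl (\<rho> y a) \<in> WJ"
      using refl_WJ[OF a] refl_conjugate[OF y D_root[OF a]] by (metis imageI)
    have ya: "\<rho> y a \<in> \<Phi>" "\<rho> y a \<noteq> 0"
      using \<rho>_root[OF y D_root[OF a]] zero_notin_\<Phi> by auto
    show "\<rho> y a \<in> span D"
    proof (rule in_span_if_perp_perp)
      fix u assume "\<And>a. a \<in> D \<Longrightarrow> u \<bullet> a = 0"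
      then have "reflection (\<rho> y a) u = u"
        using WJ_fixes_perp[OF r] \<rho>_refl[OF ya(1)] by simp
      then show "\<rho> y a \<bullet> u = 0"
        using ya(2) by (simp add: reflection_def inner_commute)
    qed
  next
    assume y: "y \<in> carrier W" and span: "\<forall>a\<in>D. \<rho> y a \<in> span D"
    have "y \<otimes> g \<otimes> inv y \<in> WJ" if g: "g \<in> WJ" for g
    proof (rule in_WJ_if_fixes_perp)
      fix v assume v: "\<And>a. a \<in> D \<Longrightarrow> v \<bullet> a = 0"
      have "\<rho> (inv y) v \<bullet> a = 0" if "a \<in> D" for a
        using perp_span[OF span[rule_format, OF that] v] by (simp add: \<rho>_adjoint(1)[OF y, symmetric])
      then have "\<rho> g (\<rho> (inv y) v) = \<rho> (inv y) v"
        by (rule WJ_fixes_perp[OF g])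
      then show "\<rho> (y \<otimes> g \<otimes> inv y) v = v"
        using y WJ_carrier[OF g] by (simp add: \<rho>_mult)
    qed (use y WJ_carrier[OF g] in simp)
    moreover have "inj_on (\<lambda>g. y \<otimes> g \<otimes> inv y) WJ"
      using y WJ_carrier by (auto simp: inj_on_def)
    ultimately show "(\<lambda>g. y \<otimes> g \<otimes> inv y) ` WJ = WJ"
      using finite_subset[OF sub finite_W] by (intro endo_inj_surj) auto
  qed
  finally show ?thesis .
qed

lemma normalizer_subgroup: "subgroup (normalizer W WJ) W"
  by (rule normalizer_imp_subgroup) (use WJ_carrier in blast)

lemma WJ_sub_normalizer: "WJ \<subseteq> normalizer W WJ"
  using WJ_span by (auto simp: normalizer_iff WJ_carrier span_base)

text \<open>\<open>x\<close> permutes the positive roots in \<open>span D\<close>, and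
  \<open>D\<close> consists of the indecomposable ones among them.\<close>

lemma permutes_D_if_positive:
  assumes x: "x \<in> normalizer W WJ" and pos: "\<And>a. a \<in> D \<Longrightarrow> h \<bullet> \<rho> (inv x) a > 0"
  shows "\<rho> x ` D = D"
proof -
  have xc: "x \<in> carrier W"
    using x normalizer_iff by blast
  have inv_span: "\<rho> (inv x) a \<in> span D" if "a \<in> span D" for a
  proof -
    have "\<rho> (inv x) ` D \<subseteq> span D"
      using subgroup.m_inv_closed[OF normalizer_subgroup x] by (auto simp: normalizer_iff)
    moreover have "\<rho> (inv x) a \<in> span (\<rho> (inv x) ` D)"
      using that xc by (simp add: span_linear_image[OF \<rho>_linear])
    ultimately show ?thesis
      using span_minimal subspace_span by blast
  qed
  define P where "P = {b \<in> \<Phi>. b \<in> span D \<and> h \<bullet> b > 0}"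
  have "\<rho> (inv x) b \<in> P" if "b \<in> P" for b
  proof -
    have b: "b \<in> \<Phi>" "h \<bullet> b > 0" "b \<in> span D"
      using that by (auto simp: P_def)
    obtain c where c: "\<forall>a\<in>D. c a \<ge> 0" "b = (\<Sum>a\<in>D. c a *\<^sub>R a)"
      using positive_root_cone_span[OF b(1,2) D_sub b(3)] by blast
    have "\<rho> (inv x) b = (\<Sum>a\<in>D. c a *\<^sub>R \<rho> (inv x) a)"
      by (subst c(2)) (simp add: linear_sum linear_scale \<rho>_linear xc)
    then have "h \<bullet> \<rho> (inv x) b = (\<Sum>a\<in>D. c a * (h \<bullet> \<rho> (inv x) a))"
      by (simp add: inner_sum_right)
    also have "\<dots> \<ge> 0"
      using c(1) pos by (intro sum_nonneg mult_nonneg_nonneg) (auto intro: less_imp_le)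
    finally have "h \<bullet> \<rho> (inv x) b \<ge> 0" .
    moreover have "\<rho> (inv x) b \<in> \<Phi>"
      using that xc by (auto simp: P_def \<rho>_root)
    ultimately show ?thesis
      using root_not_orthogonal_h[of "\<rho> (inv x) b"] that inv_span by (auto simp: P_def)
  qed
  then have "\<rho> (inv x) ` P = P"
    using finite_\<Phi> \<rho>_inj[of "inv x" P] xc by (intro endo_inj_surj) (auto simp: P_def)
  then have "\<rho> x ` P = \<rho> x ` \<rho> (inv x) ` P"
    by simp
  also have "\<dots> = P"
    using xc by (simp add: image_image)
  finally have xP: "\<rho> x ` P = P" .
  have D_P: "D \<subseteq> P"
    using h_simple D_simple by (auto simp: P_def D_root span_base)
  have "\<rho> x a \<in> D" if a: "a \<in> D" for a
  proof (rule ccontr)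
    assume notin: "\<rho> x a \<notin> D"
    \<comment> \<open>Applying \<open>x\<inverse>\<close> and then the reflection in \<open>a\<close> to the expansion of \<open>\<rho> x a\<close> in \<open>D\<close> would write
      \<open>- a\<close> as a nonnegative combination of positive roots.\<close>
    have "\<rho> x a \<in> P"
      using xP D_P a by blast
    then have xa: "\<rho> x a \<in> \<Phi>" "h \<bullet> \<rho> x a > 0" "\<rho> x a \<in> span D"
      by (auto simp: P_def)
    obtain c where c: "\<forall>a\<in>D. c a \<ge> 0" "\<rho> x a = (\<Sum>d\<in>D. c d *\<^sub>R d)"
      using positive_root_cone_span[OF xa(1,2) D_sub xa(3)] by blast
    have "reflection a (\<rho> (inv x) (\<rho> x a)) = (\<Sum>d\<in>D. c d *\<^sub>R reflection a (\<rho> (inv x) d))"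
      unfolding c(2) by (simp add: linear_sum linear_scale \<rho>_linear xc reflection_linear)
    moreover have "a \<noteq> 0"
      using D_root[OF a] zero_notin_\<Phi> by auto
    then have "reflection a (\<rho> (inv x) (\<rho> x a)) = - a"
      using xc by (simp add: reflection_self)
    ultimately have "h \<bullet> (- a) = (\<Sum>d\<in>D. c d * (h \<bullet> reflection a (\<rho> (inv x) d)))"
      by (simp add: inner_sum_right)
    also have "\<dots> \<ge> 0"
    proof (intro sum_nonneg mult_nonneg_nonneg)
      fix d assume d: "d \<in> D"
      show "c d \<ge> 0"
        using c(1) d by blast
      have "\<rho> (inv x) d \<noteq> a"
        using notin d xc by auto
      then show "h \<bullet> reflection a (\<rho> (inv x) d) \<ge> 0"
        using reflection_simple_positive[OF D_simple[OF a], of "\<rho> (inv x) d"] pos[OF d] d xc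
        by (simp add: \<rho>_root D_root)
    qed
    finally show False
      using h_simple[OF D_simple[OF a]] by simp
  qed
  then show ?thesis
    using endo_inj_surj[OF finite_D _ \<rho>_inj[OF xc]] by blast
qed

text \<open>Folding \<open>\<rho> y h\<close> by \<open>u\<close> in \<open>WJ\<close> makes the
  inverse of \<open>u \<otimes> y\<close> positive on \<open>D\<close>, so
  \<open>u \<otimes> y\<close> permutes \<open>D\<close>.\<close>

lemma normalizer_decomposition:
  assumes y: "y \<in> normalizer W WJ"
  shows "\<exists>w\<in>WJ. \<exists>x\<in>N_set W S J. y = w \<otimes> x"
proof -
  have yc: "y \<in> carrier W"
    using y normalizer_iff by blast
  have "\<exists>u\<in>WJ. \<forall>b\<in>D. (h \<bullet> b) * (\<rho> u (\<rho> y h) \<bullet> b) \<ge> 0"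
    by (rule ex_folding)
      (auto simp: WJ_carrier D_root intro: generate.one subgroup.m_closed[OF WJ_subgroup] refl_WJ)
  then obtain u where u: "u \<in> WJ" "\<And>b. b \<in> D \<Longrightarrow> \<rho> u (\<rho> y h) \<bullet> b \<ge> 0"
    using h_simple D_simple by (metis mult_1)
  have uc: "u \<in> carrier W"
    using u WJ_carrier by blast
  have x: "u \<otimes> y \<in> normalizer W WJ"
    using u(1) y WJ_sub_normalizer subgroup.m_closed[OF normalizer_subgroup] by blast
  have "h \<bullet> \<rho> (inv (u \<otimes> y)) a > 0" if "a \<in> D" for a
  proof -
    have "h \<bullet> \<rho> (inv (u \<otimes> y)) a = \<rho> (u \<otimes> y) h \<bullet> a"
      using uc yc by (simp add: \<rho>_adjoint(2)[of "u \<otimes> y"])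
    then have "h \<bullet> \<rho> (inv (u \<otimes> y)) a \<ge> 0"
      using u(2)[OF that] uc yc by (simp add: \<rho>_mult)
    then show ?thesis
      using root_not_orthogonal_h[OF \<rho>_root[of "inv (u \<otimes> y)" a]] that uc yc
      by (simp add: D_root)
  qed
  then have "u \<otimes> y \<in> N_set W S J"
    using permutes_D_if_positive[OF x] uc yc by (simp add: N_set_iff)
  moreover have "y = inv u \<otimes> (u \<otimes> y)"
    using uc yc by (simp add: m_assoc[symmetric])
  moreover have "inv u \<in> WJ"
    using WJ_subgroup u(1) by (simp add: subgroup.m_inv_closed)
  ultimately show ?thesis by blast
qed

section \<open>Bulkiness in terms of the action on \<open>D\<close>\<close>

lemma fixes_span:
  assumes "x \<in> carrier W" "\<And>a. a \<in> D \<Longrightarrow> \<rho> x a = a" "v \<in> span D"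
  shows "\<rho> x v = v"
  using linear_eq_on_span[OF \<rho>_linear[OF assms(1)] linear_id, of D v] assms by simp

text \<open>In a direct product \<open>x\<close> commutes with \<open>refl a\<close>, so
  \<open>\<rho> x a\<close> is \<open>a\<close> or \<open>- a\<close>, and it is a simple root.
  Conversely, an \<open>x\<close> that fixes \<open>D\<close> is trivial on \<open>span D\<close>
  and preserves the complement, where \<open>WJ\<close> is trivial; so it commutes with
  \<open>WJ\<close>, and the \<open>WJ\<close>-factor of a product can be read off on
  \<open>D\<close>.\<close>

lemma bulky_iff:
  "bulky W S J \<longleftrightarrow> (\<forall>x\<in>N_set W S J. \<forall>a\<in>D. \<rho> x a = a)"
proof
  assume bulky: "bulky W S J"
  show "\<forall>x\<in>N_set W S J. \<forall>a\<in>D. \<rho> x a = a"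
  proof (intro ballI)
    fix x a assume x: "x \<in> N_set W S J" and a: "a \<in> D"
    have xc: "x \<in> carrier W" and ac: "refl a \<in> carrier W" and xa: "\<rho> x a \<in> D"
      using x a by (auto simp: N_set_iff refl_closed D_root)
    have "\<one> \<in> N_set W S J"
      by (simp add: N_set_iff)
    have "(\<lambda>(w, x). w \<otimes> x) \<in>
        hom (W\<lparr>carrier := WJ\<rparr> \<times>\<times> W\<lparr>carrier := N_set W S J\<rparr>) (W\<lparr>carrier := normalizer W WJ\<rparr>)"
      using bulky by (simp add: bulky_def iso_def)
    from hom_mult[OF this, of "(\<one>, x)" "(refl a, \<one>)"]
    have "refl a \<otimes> x = x \<otimes> refl a"
      using x xc ac refl_WJ[OF a] \<open>\<one> \<in> N_set W S J\<close> by (simp add: generate.one)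
    then have "x \<otimes> refl a \<otimes> inv x = refl a"
      using xc ac by (metis inv_solve_right m_closed)
    then have "refl (\<rho> x a) = refl a"
      using refl_conjugate[OF xc D_root[OF a]] by simp
    then have "\<rho> x a = a \<or> \<rho> x a = - a"
      using refl_eq_iff xa a D_root by blast
    moreover have "\<rho> x a \<noteq> - a"
      using h_simple[OF D_simple[OF xa]] h_simple[OF D_simple[OF a]] by auto
    ultimately show "\<rho> x a = a" by blast
  qed
next
  assume fixed: "\<forall>x\<in>N_set W S J. \<forall>a\<in>D. \<rho> x a = a"
  let ?f = "\<lambda>(w, x). w \<otimes> x"
  have N: "x \<in> carrier W" "\<rho> x ` D = D" if "x \<in> N_set W S J" for x
    using that by (auto simp: N_set_iff)
  have N_span: "\<rho> x v = v" if "x \<in> N_set W S J" "v \<in> span D" for x v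
    using fixes_span[OF N(1)] that fixed by blast
  have N_perp: "\<rho> x v \<bullet> a = 0" if "x \<in> N_set W S J" "\<And>a. a \<in> D \<Longrightarrow> v \<bullet> a = 0" "a \<in> D" for x v a
    using that \<rho>_inner[OF N(1)[OF that(1)], of v a] fixed by simp
  have comm: "x \<otimes> w = w \<otimes> x" if x: "x \<in> N_set W S J" and w: "w \<in> WJ" for x w
  proof (rule \<rho>_eqI)
    fix v
    have c: "x \<otimes> w \<in> carrier W" "w \<otimes> x \<in> carrier W"
      using N(1)[OF x] WJ_carrier[OF w] by auto
    show "\<rho> (x \<otimes> w) v = \<rho> (w \<otimes> x) v"
    proof (rule linear_eq_on_span_perp[OF \<rho>_linear[OF c(1)] \<rho>_linear[OF c(2)], where D = D])
      show "\<rho> (x \<otimes> w) a = \<rho> (w \<otimes> x) a" if "a \<in> D" for a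
        using N(1)[OF x] WJ_carrier[OF w] N_span[OF x] WJ_span[OF w] that
        by (simp add: \<rho>_mult span_base)
      show "\<rho> (x \<otimes> w) u = \<rho> (w \<otimes> x) u" if "\<And>a. a \<in> D \<Longrightarrow> u \<bullet> a = 0" for u
        using N(1)[OF x] WJ_carrier[OF w] WJ_fixes_perp[OF w] N_perp[OF x that] that
        by (simp add: \<rho>_mult)
    qed
  qed (use N(1)[OF x] WJ_carrier[OF w] in auto)
  have "inj_on ?f (WJ \<times> N_set W S J)"
  proof (rule inj_onI, clarsimp)
    fix w x w' x'
    assume w: "w \<in> WJ" "w' \<in> WJ" and x: "x \<in> N_set W S J" "x' \<in> N_set W S J"
      and eq: "w \<otimes> x = w' \<otimes> x'"
    note c = WJ_carrier[OF w(1)] WJ_carrier[OF w(2)] N(1)[OF x(1)] N(1)[OF x(2)]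
    have "w = w'"
    proof (rule \<rho>_eqI[OF c(1,2)])
      fix v
      show "\<rho> w v = \<rho> w' v"
      proof (rule linear_eq_on_span_perp[OF \<rho>_linear[OF c(1)] \<rho>_linear[OF c(2)], where D = D])
        show "\<rho> w a = \<rho> w' a" if "a \<in> D" for a
          using \<rho>_mult[OF c(1,3), of a] \<rho>_mult[OF c(2,4), of a] eq fixed x that by simp
        show "\<rho> w u = \<rho> w' u" if "\<And>a. a \<in> D \<Longrightarrow> u \<bullet> a = 0" for u
          using WJ_fixes_perp w that by simp
      qed
    qed
    moreover from this have "x = x'"
      using eq c by simp
    ultimately show "w = w' \<and> x = x'" ..
  qed
  moreover have "?f ` (WJ \<times> N_set W S J) = normalizer W WJ"
  proof (intro equalityI subsetI)
    fix y assume "y \<in> ?f ` (WJ \<times> N_set W S J)"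
    then obtain w x where w: "w \<in> WJ" and x: "x \<in> N_set W S J" and y: "y = w \<otimes> x"
      by auto
    have "x \<in> normalizer W WJ"
      using N(1)[OF x] fixed x by (simp add: normalizer_iff span_base)
    then show "y \<in> normalizer W WJ"
      using WJ_sub_normalizer w y subgroup.m_closed[OF normalizer_subgroup] by blast
  next
    fix y assume "y \<in> normalizer W WJ"
    then show "y \<in> ?f ` (WJ \<times> N_set W S J)"
      using normalizer_decomposition by force
  qed
  moreover have "w \<otimes> w' \<otimes> (x \<otimes> x') = w \<otimes> x \<otimes> (w' \<otimes> x')"
    if "w \<in> WJ" "w' \<in> WJ" "x \<in> N_set W S J" "x' \<in> N_set W S J" for w w' x x'
  proof -
    note c = WJ_carrier[OF that(1)] WJ_carrier[OF that(2)] N(1)[OF that(3)] N(1)[OF that(4)]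
    have "w' \<otimes> (x \<otimes> x') = x \<otimes> (w' \<otimes> x')"
      using comm[OF that(3,2)] c by (simp add: m_assoc[symmetric])
    then show ?thesis
      using c by (simp add: m_assoc)
  qed
  ultimately show "bulky W S J"
    unfolding bulky_def by (auto simp: iso_def hom_def bij_betw_def)
qed

end

section \<open>Parabolic subgroups with central longest element\<close>

locale central_parabolic = parabolic W S \<Phi> \<Delta> \<rho> h D
  for W :: "('w, 'm) monoid_scheme" (structure) and S :: "'w set"
    and \<Phi> \<Delta> :: "'v::euclidean_space set" and \<rho> :: "'w \<Rightarrow> 'v \<Rightarrow> 'v" and h :: 'v and D :: "'v set" +
  assumes central: "x \<in> WJ \<Longrightarrow> longest_element W S J \<otimes> x = x \<otimes> longest_element W S J"
begin

definition \<sigma> :: 'w where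
  "\<sigma> = longest_element W S J"

lemma \<sigma>_WJ: "\<sigma> \<in> WJ"
  and \<sigma>_maximal: "x \<in> WJ \<Longrightarrow> len x \<le> len \<sigma>"
proof -
  \<comment> \<open>\<open>longest_element\<close> is a choice of a maximiser; a strict upper bound
    on the lengths guarantees that one exists.\<close>
  have "\<forall>x. x \<in> WJ \<longrightarrow> len x < Suc (Max (len ` WJ))"
    using WJ_carrier finite_subset[OF _ finite_W, of WJ] by (auto simp: less_Suc_eq_le intro: Max_ge)
  note max = arg_max_natI[OF generate.one this] arg_max_nat_le[OF _ this]
  from max(1) show "\<sigma> \<in> WJ"
    by (simp add: \<sigma>_def longest_element_def arg_max_on_def)
  from max(2) show "len x \<le> len \<sigma>" if "x \<in> WJ"
    using that by (simp add: \<sigma>_def longest_element_def arg_max_on_def)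
qed

lemma \<sigma>_carrier [simp]: "\<sigma> \<in> carrier W"
  using WJ_carrier \<sigma>_WJ by blast

text \<open>Centrality gives \<open>\<rho> \<sigma> a = a\<close> or
  \<open>\<rho> \<sigma> a = - a\<close>, and the plus sign would make
  \<open>\<sigma> \<otimes> refl a\<close> longer than \<open>\<sigma>\<close>.\<close>

lemma \<sigma>_simple:
  assumes a: "a \<in> D"
  shows "\<rho> \<sigma> a = - a"
proof -
  have ac: "refl a \<in> carrier W"
    using a by (simp add: refl_closed D_root)
  have "\<sigma> \<otimes> refl a = refl a \<otimes> \<sigma>"
    using central[OF refl_WJ[OF a]] by (simp add: \<sigma>_def)
  then have "\<sigma> \<otimes> refl a \<otimes> inv \<sigma> = refl a"
    using ac by (simp add: m_assoc)
  then have "refl (\<rho> \<sigma> a) = refl a"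
    using refl_conjugate[of \<sigma> a] a by (simp add: D_root)
  then have "\<rho> \<sigma> a = a \<or> \<rho> \<sigma> a = - a"
    using refl_eq_iff[of "\<rho> \<sigma> a" a] a by (simp add: D_root \<rho>_root)
  moreover have "len (\<sigma> \<otimes> refl a) \<le> len \<sigma>"
    using \<sigma>_maximal \<sigma>_WJ refl_WJ[OF a] by (simp add: generate.eng)
  then have "\<not> h \<bullet> \<rho> \<sigma> a > 0"
    using len_mult_simple_iff[of \<sigma> a] D_simple[OF a] by simp
  ultimately show ?thesis
    using h_simple[OF D_simple[OF a]] by auto
qed

lemma \<sigma>_span: "v \<in> span D \<Longrightarrow> \<rho> \<sigma> v = - v"
proof -
  have "linear (\<lambda>v::'v. - v)"
    by (rule linearI) simp_all
  then show "v \<in> span D \<Longrightarrow> \<rho> \<sigma> v = - v"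
    using linear_eq_on_span[OF \<rho>_linear[OF \<sigma>_carrier], of "\<lambda>v. - v" D v] \<sigma>_simple by simp
qed

lemma \<sigma>_perp: "(\<And>a. a \<in> D \<Longrightarrow> v \<bullet> a = 0) \<Longrightarrow> \<rho> \<sigma> v = v"
  using WJ_fixes_perp[OF \<sigma>_WJ] .

lemma \<sigma>_\<sigma>: "\<sigma> \<otimes> \<sigma> = \<one>"
proof (rule \<rho>_eqI)
  fix v
  show "\<rho> (\<sigma> \<otimes> \<sigma>) v = \<rho> \<one> v"
    by (rule linear_eq_on_span_perp[OF \<rho>_linear \<rho>_linear, where D = D])
      (auto simp: \<rho>_mult \<sigma>_simple linear_neg[OF \<rho>_linear] \<sigma>_perp)
qed auto

lemma \<rho>_\<sigma>_\<sigma> [simp]: "\<rho> \<sigma> (\<rho> \<sigma> v) = v"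
  using \<sigma>_\<sigma> \<rho>_mult[of \<sigma> \<sigma> v] by simp

lemma \<sigma>_inv [simp]: "inv \<sigma> = \<sigma>"
  using \<sigma>_\<sigma> by (simp add: inv_equality)

lemma \<sigma>_adjoint: "\<rho> \<sigma> x \<bullet> y = x \<bullet> \<rho> \<sigma> y"
  using \<rho>_adjoint(2)[OF \<sigma>_carrier] by simp

text \<open>\<open>\<rho> \<sigma>\<close> is self-adjoint, so its fixed vectors are orthogonal to
  \<open>D\<close>, which it negates.\<close>

lemma \<sigma>_fix_iff: "\<rho> \<sigma> v = v \<longleftrightarrow> (\<forall>a\<in>D. v \<bullet> a = 0)"
proof
  assume "\<rho> \<sigma> v = v"
  show "\<forall>a\<in>D. v \<bullet> a = 0"
  proof
    fix a assume "a \<in> D"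
    then have "v \<bullet> a = - (v \<bullet> a)"
      using \<sigma>_adjoint[of v a] \<open>\<rho> \<sigma> v = v\<close> by (simp add: \<sigma>_simple)
    then show "v \<bullet> a = 0" by simp
  qed
qed (use \<sigma>_perp in blast)

lemma \<sigma>_neg_iff: "\<rho> \<sigma> v = - v \<longleftrightarrow> v \<in> span D"
proof
  assume v: "\<rho> \<sigma> v = - v"
  show "v \<in> span D"
  proof (rule in_span_if_perp_perp)
    fix u assume "\<And>a. a \<in> D \<Longrightarrow> u \<bullet> a = 0"
    then have "\<rho> \<sigma> u = u"
      by (rule \<sigma>_perp)
    then have "v \<bullet> u = - (v \<bullet> u)"
      using \<sigma>_adjoint[of v u] v by simp
    then show "v \<bullet> u = 0" by simp
  qed
qed (rule \<sigma>_span)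

text \<open>These are the usual projectors of an involution; uniqueness follows by applying
  \<open>\<rho> \<sigma>\<close> to \<open>p\<close> and \<open>b - p\<close>.\<close>

lemma proj_along_eigen:
  assumes b: "b \<in> \<Phi>" and \<epsilon>: "\<epsilon> \<in> {1, -1}"
  shows "proj_along (eigen \<Phi> \<rho> \<sigma> \<epsilon>) (eigen \<Phi> \<rho> \<sigma> (- \<epsilon>)) b = (1/2) *\<^sub>R (b + \<epsilon> *\<^sub>R \<rho> \<sigma> b)"
  unfolding proj_along_def
proof (rule the_equality)
  have lin: "\<rho> \<sigma> (x + y) = \<rho> \<sigma> x + \<rho> \<sigma> y" "\<rho> \<sigma> (x - y) = \<rho> \<sigma> x - \<rho> \<sigma> y"
    "\<rho> \<sigma> (c *\<^sub>R x) = c *\<^sub>R \<rho> \<sigma> x" for x y c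
    by (simp_all add: linear_add linear_diff linear_scale \<rho>_linear)
  have \<epsilon>2: "\<epsilon> * \<epsilon> = 1"
    using \<epsilon> by auto
  have b_span: "b \<in> span \<Phi>" "\<rho> \<sigma> b \<in> span \<Phi>"
    using b by (auto simp: span_base \<rho>_root)
  have diff: "b - (1/2) *\<^sub>R (b + \<epsilon> *\<^sub>R \<rho> \<sigma> b) = (1/2) *\<^sub>R (b - \<epsilon> *\<^sub>R \<rho> \<sigma> b)"
    by (simp add: algebra_simps flip: scaleR_add_left)
  have "(1/2) *\<^sub>R (b + \<epsilon> *\<^sub>R \<rho> \<sigma> b) \<in> eigen \<Phi> \<rho> \<sigma> \<epsilon>"
    using b_span \<epsilon>2
    by (simp add: eigen_def lin span_add span_scale scaleR_add_right add.commute)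
  moreover have "(1/2) *\<^sub>R (b - \<epsilon> *\<^sub>R \<rho> \<sigma> b) \<in> eigen \<Phi> \<rho> \<sigma> (- \<epsilon>)"
    using b_span \<epsilon>2
    by (simp add: eigen_def lin span_diff span_scale scaleR_diff_right)
  ultimately show "(1/2) *\<^sub>R (b + \<epsilon> *\<^sub>R \<rho> \<sigma> b) \<in> eigen \<Phi> \<rho> \<sigma> \<epsilon> \<and>
      b - (1/2) *\<^sub>R (b + \<epsilon> *\<^sub>R \<rho> \<sigma> b) \<in> eigen \<Phi> \<rho> \<sigma> (- \<epsilon>)"
    unfolding diff ..
  fix p assume "p \<in> eigen \<Phi> \<rho> \<sigma> \<epsilon> \<and> b - p \<in> eigen \<Phi> \<rho> \<sigma> (- \<epsilon>)"
  then have "\<rho> \<sigma> p = \<epsilon> *\<^sub>R p" "\<rho> \<sigma> b - \<rho> \<sigma> p = - \<epsilon> *\<^sub>R (b - p)"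
    by (auto simp: eigen_def lin)
  then have "\<rho> \<sigma> b = \<epsilon> *\<^sub>R (2 *\<^sub>R p - b)"
    by (simp add: algebra_simps scaleR_2)
  then have "\<epsilon> *\<^sub>R \<rho> \<sigma> b = 2 *\<^sub>R p - b"
    using \<epsilon>2 by simp
  then show "p = (1/2) *\<^sub>R (b + \<epsilon> *\<^sub>R \<rho> \<sigma> b)"
    by simp
qed

text \<open>The disjuncts are the cases \<open>\<epsilon> = 1\<close> and
  \<open>\<epsilon> = -1\<close>; the factor \<open>1/2\<close> of the projection is absorbed into
  \<open>k\<close>.\<close>

lemma special_iff:
  "special_involution W \<Phi> \<rho> \<sigma> \<longleftrightarrow>
    (\<forall>b\<in>\<Phi>. (\<exists>c\<in>\<Phi>. \<rho> \<sigma> c = c \<and> (\<exists>k. b + \<rho> \<sigma> b = k *\<^sub>R c)) \<or>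
            (\<exists>c\<in>\<Phi>. \<rho> \<sigma> c = - c \<and> (\<exists>k. b - \<rho> \<sigma> b = k *\<^sub>R c)))"
proof -
  have half: "(\<exists>k. (1/2) *\<^sub>R x = k *\<^sub>R c) \<longleftrightarrow> (\<exists>k. x = k *\<^sub>R c)" for x c :: 'v
  proof
    assume "\<exists>k. (1/2) *\<^sub>R x = k *\<^sub>R c"
    then obtain k where "(1/2) *\<^sub>R x = k *\<^sub>R c" ..
    then have "2 *\<^sub>R ((1/2) *\<^sub>R x) = 2 *\<^sub>R (k *\<^sub>R c)"
      by (rule arg_cong)
    then have "x = (2 * k) *\<^sub>R c"
      by simp
    then show "\<exists>k. x = k *\<^sub>R c" ..
  next
    assume "\<exists>k. x = k *\<^sub>R c"
    then obtain k where "x = k *\<^sub>R c" ..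
    then have "(1/2) *\<^sub>R x = (k / 2) *\<^sub>R c"
      by simp
    then show "\<exists>k. (1/2) *\<^sub>R x = k *\<^sub>R c" ..
  qed
  have root_eigen: "c \<in> \<Phi> \<inter> eigen \<Phi> \<rho> \<sigma> \<epsilon> \<longleftrightarrow> c \<in> \<Phi> \<and> \<rho> \<sigma> c = \<epsilon> *\<^sub>R c" for c \<epsilon>
    by (auto simp: eigen_def span_base)
  have "(\<exists>\<epsilon>\<in>{1, -1}. \<exists>\<beta>\<in>\<Phi> \<inter> eigen \<Phi> \<rho> \<sigma> \<epsilon>. \<exists>c.
        proj_along (eigen \<Phi> \<rho> \<sigma> \<epsilon>) (eigen \<Phi> \<rho> \<sigma> (- \<epsilon>)) b = c *\<^sub>R \<beta>) \<longleftrightarrow>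
      (\<exists>\<epsilon>\<in>{1, -1}. \<exists>c\<in>\<Phi>. \<rho> \<sigma> c = \<epsilon> *\<^sub>R c \<and> (\<exists>k. b + \<epsilon> *\<^sub>R \<rho> \<sigma> b = k *\<^sub>R c))"
    if "b \<in> \<Phi>" for b
  proof (rule bex_cong[OF HOL.refl])
    fix \<epsilon> :: real assume "\<epsilon> \<in> {1, -1}"
    show "(\<exists>\<beta>\<in>\<Phi> \<inter> eigen \<Phi> \<rho> \<sigma> \<epsilon>. \<exists>c.
        proj_along (eigen \<Phi> \<rho> \<sigma> \<epsilon>) (eigen \<Phi> \<rho> \<sigma> (- \<epsilon>)) b = c *\<^sub>R \<beta>) \<longleftrightarrow>
      (\<exists>c\<in>\<Phi>. \<rho> \<sigma> c = \<epsilon> *\<^sub>R c \<and> (\<exists>k. b + \<epsilon> *\<^sub>R \<rho> \<sigma> b = k *\<^sub>R c))"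
      unfolding proj_along_eigen[OF that \<open>\<epsilon> \<in> {1, -1}\<close>] half using root_eigen by blast
  qed
  then show ?thesis
    unfolding special_involution_def by (simp add: \<sigma>_\<sigma>)
qed

section \<open>Special implies bulky\<close>

lemma special_imp_fixes:
  assumes special: "special_involution W \<Phi> \<rho> \<sigma>" and x: "x \<in> N_set W S J" and a: "a \<in> D"
  shows "\<rho> x a = a"
proof -
  have xc: "x \<in> carrier W" and xD: "\<rho> x ` D = D" and xD': "\<rho> (inv x) ` D = D"
    using x permutes_D_inv by (auto simp: N_set_iff)
  \<comment> \<open>\<open>p\<close> and \<open>q\<close> are twice the components of
    \<open>h\<close> in the two eigenspaces, so they inherit the regularity of \<open>h\<close> on
    the roots lying there.\<close>
  define p where "p = h + \<rho> \<sigma> h"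
  define q where "q = h - \<rho> \<sigma> h"
  have p: "\<rho> \<sigma> p = p" and q: "q \<in> span D"
    by (simp_all add: p_def q_def flip: \<sigma>_neg_iff add: linear_add linear_diff \<rho>_linear)
  have p_b: "p \<bullet> b = h \<bullet> (b + \<rho> \<sigma> b)" and q_b: "q \<bullet> b = h \<bullet> (b - \<rho> \<sigma> b)" for b
    by (simp_all add: p_def q_def inner_add_left inner_diff_left inner_add_right inner_diff_right \<sigma>_adjoint)
  have q_simple: "q \<bullet> a = 2" if "a \<in> D" for a
    using that h_simple[OF D_simple[OF that]] by (simp add: q_b \<sigma>_simple inner_add_right)
  have p_root: "p \<bullet> b \<noteq> 0" if "b \<in> \<Phi>" "\<rho> \<sigma> b = b" for b
    using root_not_orthogonal_h[OF that(1)] that(2) by (simp add: p_b inner_add_right)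
  \<comment> \<open>Within \<open>span D\<close>, the vector \<open>q\<close> is determined by
    having inner product 2 with every element of \<open>D\<close>, a condition invariant under
    permutations of \<open>D\<close>.\<close>
  have xq: "\<rho> x q = q"
  proof -
    have "\<rho> x q - q \<in> span D"
    proof (rule span_diff[OF _ q])
      have "\<rho> x q \<in> span (\<rho> x ` D)"
        using q xc by (simp add: span_linear_image[OF \<rho>_linear])
      then show "\<rho> x q \<in> span D"
        using xD by simp
    qed
    moreover have "(\<rho> x q - q) \<bullet> a = 0" if "a \<in> D" for a
    proof -
      have "\<rho> (inv x) a \<in> D"
        using xD' that by blast
      then show ?thesis
        using q_simple that by (simp add: inner_diff_left \<rho>_adjoint(2)[OF xc])
    qed
    ultimately show ?thesis
      using span_perp_zero by fastforce
  qed
  \<comment> \<open>Roots in \<open>B\<close> are orthogonal to \<open>D\<close>, so their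
    reflections fix \<open>D\<close>, and folding inside \<open>G\<close> does not change the action
    on \<open>D\<close>.\<close>
  define G where "G = {u \<in> carrier W. \<forall>a\<in>D. \<rho> u a = a}"
  define B where "B = {b \<in> \<Phi>. \<rho> \<sigma> b = b}"
  have "\<exists>u\<in>G. \<forall>b\<in>B. (p \<bullet> b) * (\<rho> u (\<rho> x p) \<bullet> b) \<ge> 0"
  proof (rule ex_folding)
    show "G \<noteq> {}"
      using one_closed \<rho>_one by (auto simp: G_def)
    show "refl b \<otimes> g \<in> G" if "b \<in> B" "g \<in> G" for b g
      using that
      by (auto simp: G_def B_def \<rho>_mult refl_closed \<rho>_refl \<sigma>_fix_iff inner_commute intro!: reflection_fixes)
  qed (auto simp: G_def B_def)
  then obtain u where u: "u \<in> G" "\<forall>b\<in>B. (p \<bullet> b) * (\<rho> u (\<rho> x p) \<bullet> b) \<ge> 0"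
    by blast
  have uc: "u \<in> carrier W" and u_fix: "\<And>v. v \<in> span D \<Longrightarrow> \<rho> u v = v"
    using u(1) fixes_span by (auto simp: G_def)
  define z where "z = u \<otimes> x"
  have zc: "z \<in> carrier W"
    using uc xc by (simp add: z_def)
  have zD: "\<rho> z ` D = D"
    using u(1) xD uc xc by (force simp: z_def \<rho>_mult G_def)
  have perp: "\<rho> \<sigma> (\<rho> y v) = \<rho> y v" if "y \<in> carrier W" "\<rho> y ` D = D" "\<rho> \<sigma> v = v" for y v
    unfolding \<sigma>_fix_iff
  proof
    fix a assume "a \<in> D"
    then have "\<rho> (inv y) a \<in> D"
      using permutes_D_inv[OF that(1,2)] by blast
    then show "\<rho> y v \<bullet> a = 0"
      using that(1,3) \<sigma>_fix_iff by (simp add: \<rho>_adjoint(2))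
  qed
  \<comment> \<open>The inverse of \<open>z\<close> maps \<open>b\<close> to another root fixed by
    \<open>\<sigma>\<close>, and \<open>p\<close> is orthogonal to no such root.\<close>
  have strict: "(p \<bullet> b) * (\<rho> z p \<bullet> b) > 0" if b: "b \<in> \<Phi>" "\<rho> \<sigma> b = b" for b
  proof -
    have "\<rho> \<sigma> (\<rho> (inv z) b) = \<rho> (inv z) b"
      using perp[of "inv z" b] b zc permutes_D_inv[OF zc zD] by simp
    then have "p \<bullet> \<rho> (inv z) b \<noteq> 0"
      using b zc by (intro p_root) (simp_all add: \<rho>_root)
    then have "\<rho> z p \<bullet> b \<noteq> 0"
      by (simp add: \<rho>_adjoint(2)[OF zc])
    moreover have "(p \<bullet> b) * (\<rho> z p \<bullet> b) \<ge> 0"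
      using u(2) b uc xc by (simp add: B_def z_def \<rho>_mult)
    ultimately show ?thesis
      using p_root[OF b] by (simp add: order_less_le)
  qed
  have "z = \<one>"
  proof (rule eq_one_if_fixes_same_chamber[OF zc subspace_span[of "{q}"]])
    have "\<rho> z q = q"
      using u_fix[OF q] uc xc xq by (simp add: z_def \<rho>_mult)
    then show "\<rho> z v = v" if "v \<in> span {q}" for v
      using linear_eq_on_span[OF \<rho>_linear[OF zc] linear_id, of "{q}" v] that by simp
  next
    fix b assume b: "b \<in> \<Phi>" "\<And>v. v \<in> span {q} \<Longrightarrow> b \<bullet> v = 0"
    then have bq: "q \<bullet> b = 0"
      using b(2)[of q] by (simp add: span_base inner_commute[of q])
    \<comment> \<open>In the other case \<open>q \<bullet> b = 0\<close> forces
      \<open>k = 0\<close>, so \<open>b\<close> is itself fixed by \<open>\<sigma>\<close> and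
      serves as \<open>c\<close>.\<close>
    have "\<exists>c\<in>\<Phi>. \<rho> \<sigma> c = c \<and> (\<exists>k. b + \<rho> \<sigma> b = k *\<^sub>R c)"
    proof -
      have "?thesis \<or> (\<exists>c\<in>\<Phi>. \<rho> \<sigma> c = - c \<and> (\<exists>k. b - \<rho> \<sigma> b = k *\<^sub>R c))"
        using special b(1) unfolding special_iff by (rule bspec)
      then show ?thesis
      proof
        assume "\<exists>c\<in>\<Phi>. \<rho> \<sigma> c = - c \<and> (\<exists>k. b - \<rho> \<sigma> b = k *\<^sub>R c)"
        then obtain c k where c: "c \<in> \<Phi>" "b - \<rho> \<sigma> b = k *\<^sub>R c"
          by blast
        then have "k = 0"
          using bq root_not_orthogonal_h[OF c(1)] by (simp add: q_b)
        with c have "\<rho> \<sigma> b = b"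
          by simp
        then show ?thesis
          using b(1) scaleR_2[of b] by metis
      qed
    qed
    then obtain c k where c: "c \<in> \<Phi>" "\<rho> \<sigma> c = c" "b + \<rho> \<sigma> b = k *\<^sub>R c"
      by blast
    have "k \<noteq> 0"
    proof
      assume "k = 0"
      then have "\<rho> \<sigma> b = - b"
        using c(3) by (simp add: add_eq_0_iff)
      then show False
        using bq root_not_orthogonal_h[OF b(1)] by (simp add: q_b inner_add_right)
    qed
    have eq: "2 * (b \<bullet> v) = k * (v \<bullet> c)" if "\<rho> \<sigma> v = v" for v
    proof -
      have "2 * (b \<bullet> v) = (b + \<rho> \<sigma> b) \<bullet> v"
        using that by (simp add: inner_add_left \<sigma>_adjoint)
      then show ?thesis
        by (simp add: c(3) inner_commute)
    qed
    \<comment> \<open>Against vectors fixed by \<open>\<sigma>\<close>, \<open>b\<close> acts as a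
      nonzero multiple of \<open>c\<close>; the unknown sign of \<open>k\<close> disappears in the
      square.\<close>
    have "2 * (b \<bullet> p) * (2 * (b \<bullet> \<rho> z p)) = k\<^sup>2 * ((p \<bullet> c) * (\<rho> z p \<bullet> c))"
      using eq[OF p] eq[OF perp[OF zc zD p]] by (simp add: power2_eq_square)
    also have "\<dots> > 0"
      using strict[OF c(1,2)] \<open>k \<noteq> 0\<close> by simp
    finally show "b \<bullet> p * (b \<bullet> \<rho> z p) > 0"
      by simp
  qed
  then have "\<rho> u (\<rho> x a) = a"
    using \<rho>_mult[OF uc xc, of a] by (simp add: z_def)
  moreover have "\<rho> u (\<rho> x a) = \<rho> x a"
    using a xD by (intro u_fix span_base) blast
  ultimately show ?thesis by simp
qed

section \<open>Bulky implies special\<close>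

lemma fixes_imp_special:
  assumes fixed: "\<And>x a. x \<in> N_set W S J \<Longrightarrow> a \<in> D \<Longrightarrow> \<rho> x a = a"
  shows "special_involution W \<Phi> \<rho> \<sigma>"
  unfolding special_iff
proof (rule ballI, rule ccontr)
  fix b assume b: "b \<in> \<Phi>"
    and not_special: "\<not> ((\<exists>c\<in>\<Phi>. \<rho> \<sigma> c = c \<and> (\<exists>k. b + \<rho> \<sigma> b = k *\<^sub>R c)) \<or>
            (\<exists>c\<in>\<Phi>. \<rho> \<sigma> c = - c \<and> (\<exists>k. b - \<rho> \<sigma> b = k *\<^sub>R c)))"
  define e where "e = b - \<rho> \<sigma> b"
  define f where "f = b + \<rho> \<sigma> b"
  have \<sigma>e: "\<rho> \<sigma> e = - e" and \<sigma>f: "\<rho> \<sigma> f = f"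
    by (simp_all add: e_def f_def linear_add linear_diff \<rho>_linear)
  have lin: "\<rho> w (x + y) = \<rho> w x + \<rho> w y" "\<rho> w (x - y) = \<rho> w x - \<rho> w y"
    "\<rho> w (k *\<^sub>R x) = k *\<^sub>R \<rho> w x" "\<rho> w (- x) = - \<rho> w x" if "w \<in> carrier W" for w x y k
    using that by (simp_all add: linear_add linear_diff linear_scale linear_neg \<rho>_linear)
  have ef: "e \<bullet> f = 0"
    using \<sigma>_adjoint[of e f] by (simp add: \<sigma>e \<sigma>f)
  \<comment> \<open>If \<open>k = 0\<close>, then \<open>b\<close> is fixed by
    \<open>\<sigma>\<close> and witnesses the first disjunct; otherwise \<open>c\<close> is negated
    by \<open>\<sigma>\<close> and witnesses the second.\<close>
  have not_e: "e \<noteq> k *\<^sub>R c" if "c \<in> \<Phi>" for k c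
  proof
    assume e: "e = k *\<^sub>R c"
    show False
    proof (cases "k = 0")
      case True
      then have "\<rho> \<sigma> b = b"
        using e by (simp add: e_def)
      then show False
        using not_special b scaleR_2[of b] by metis
    next
      case False
      then have "\<rho> \<sigma> c = - c"
        using \<sigma>e lin(3)[OF \<sigma>_carrier, of k c] by (simp add: e flip: scaleR_minus_right)
      then show False
        using not_special that e unfolding e_def by blast
    qed
  qed
  have not_f: "f \<noteq> k *\<^sub>R c" if "c \<in> \<Phi>" for k c
  proof
    assume f: "f = k *\<^sub>R c"
    show False
    proof (cases "k = 0")
      case True
      then have "\<rho> \<sigma> b = - b"
        using f by (simp add: f_def add_eq_0_iff)
      moreover from this have "b - \<rho> \<sigma> b = 2 *\<^sub>R b"
        by (simp add: scaleR_2)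
      ultimately show False
        using not_special b by blast
    next
      case False
      then have "\<rho> \<sigma> c = c"
        using \<sigma>f lin(3)[OF \<sigma>_carrier, of k c] by (simp add: f)
      then show False
        using not_special that f unfolding f_def by blast
    qed
  qed
  have e0: "e \<noteq> 0" and f0: "f \<noteq> 0"
    using not_e[OF b, of 0] not_f[OF b, of 0] by auto
  \<comment> \<open>\<open>B\<close> consists of the roots in the plane of \<open>e\<close> and
    \<open>f\<close>, and \<open>G\<close> is the pointwise stabiliser of the complement
    \<open>U\<close> of that plane.\<close>
  define U where "U = {v. v \<bullet> e = 0 \<and> v \<bullet> f = 0}"
  define G where "G = {g \<in> carrier W. \<forall>v\<in>U. \<rho> g v = v}"
  define B where "B = {c \<in> \<Phi>. \<forall>v\<in>U. c \<bullet> v = 0}"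
  have plane: "\<exists>s t. x = s *\<^sub>R e + t *\<^sub>R f" if "\<And>v. v \<in> U \<Longrightarrow> x \<bullet> v = 0" for x
  proof -
    have "x \<in> span {e, f}"
      by (rule in_span_if_perp_perp) (use that in \<open>auto simp: U_def\<close>)
    then show ?thesis
      by (auto simp: span_insert span_singleton algebra_simps)
  qed
  have \<sigma>U: "\<rho> \<sigma> v \<in> U" if "v \<in> U" for v
    using that by (auto simp: U_def \<sigma>_adjoint \<sigma>e \<sigma>f)
  have \<sigma>B: "\<rho> \<sigma> c \<in> B" if "c \<in> B" for c
    using that \<sigma>U by (auto simp: B_def \<sigma>_adjoint \<rho>_root)
  have Gc: "g \<in> carrier W" "inv g \<in> G" if "g \<in> G" for g
  proof -
    show gc: "g \<in> carrier W"
      using that by (simp add: G_def)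
    have "\<rho> (inv g) v = v" if "v \<in> U" for v
      using \<rho>_inv(1)[OF gc, of v] \<open>g \<in> G\<close> that by (simp add: G_def)
    then show "inv g \<in> G"
      using gc by (simp add: G_def)
  qed
  have GB: "\<rho> g c \<in> B" if "g \<in> G" "c \<in> B" for g c
    using that Gc(2)[OF that(1)] by (auto simp: G_def B_def \<rho>_adjoint(2) \<rho>_root)
  \<comment> \<open>A root in the plane orthogonal to \<open>f\<close> would be a multiple of
    \<open>e\<close>.\<close>
  have f_B: "f \<bullet> c \<noteq> 0" if c: "c \<in> B" for c
  proof
    assume 0: "f \<bullet> c = 0"
    obtain s t where st: "c = s *\<^sub>R e + t *\<^sub>R f"
      using plane[of c] c unfolding B_def by blast
    have "c \<in> \<Phi>" "c \<noteq> 0"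
      using that zero_notin_\<Phi> by (auto simp: B_def)
    have "t = 0"
      using 0 ef f0 by (simp add: st inner_add_right inner_commute)
    then have "s \<noteq> 0" "e = (1 / s) *\<^sub>R c"
      using st \<open>c \<noteq> 0\<close> by auto
    then show False
      using not_e[OF \<open>c \<in> \<Phi>\<close>] by blast
  qed
  \<comment> \<open>Folding \<open>f\<close> towards \<open>- f\<close> produces the element of
    \<open>G\<close> that sends the chamber of \<open>f\<close> to the opposite one.\<close>
  have "\<exists>y\<in>G. \<forall>c\<in>B. (- f \<bullet> c) * (\<rho> y f \<bullet> c) \<ge> 0"
  proof (rule ex_folding)
    show "G \<noteq> {}"
      using one_closed \<rho>_one by (auto simp: G_def)
    show "refl c \<otimes> g \<in> G" if "c \<in> B" "g \<in> G" for c g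
      using that by (auto simp: G_def B_def \<rho>_mult refl_closed \<rho>_refl inner_commute intro!: reflection_fixes)
  qed (auto simp: G_def B_def)
  then obtain y where y: "y \<in> G" "\<And>c. c \<in> B \<Longrightarrow> (- f \<bullet> c) * (\<rho> y f \<bullet> c) \<ge> 0"
    by blast
  have yc: "y \<in> carrier W" and yU: "\<And>v. v \<in> U \<Longrightarrow> \<rho> y v = v"
    and y'U: "\<And>v. v \<in> U \<Longrightarrow> \<rho> (inv y) v = v"
    using y(1) Gc(2)[OF y(1)] by (auto simp: G_def)
  have opp: "(f \<bullet> c) * (\<rho> y f \<bullet> c) < 0" if "c \<in> B" for c
  proof -
    have "\<rho> y f \<bullet> c \<noteq> 0"
      using f_B[OF GB[OF Gc(2)[OF y(1)] that]] by (simp add: \<rho>_adjoint(2)[OF yc])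
    then show ?thesis
      using y(2)[OF that] f_B[OF that] by (simp add: order_less_le)
  qed
  \<comment> \<open>\<open>y\<close> maps the chamber of \<open>f\<close> in the plane to the opposite one, and \<open>\<sigma>\<close> preserves both, so their
    commutator fixes a chamber.\<close>
  define z where "z = \<sigma> \<otimes> inv y \<otimes> \<sigma> \<otimes> y"
  have z\<rho>: "\<rho> z v = \<rho> \<sigma> (\<rho> (inv y) (\<rho> \<sigma> (\<rho> y v)))" for v
    using yc by (simp add: z_def \<rho>_mult)
  have zc: "z \<in> carrier W"
    using yc by (simp add: z_def)
  have "z = \<one>"
  proof (rule eq_one_if_fixes_same_chamber[OF zc])
    show "subspace U"
      by (auto simp: U_def subspace_def inner_add_left)
    show "\<rho> z v = v" if "v \<in> U" for v
      using that \<sigma>U yU y'U by (simp add: z\<rho>)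
  next
    fix c assume "c \<in> \<Phi>" "\<And>v. v \<in> U \<Longrightarrow> c \<bullet> v = 0"
    then have c: "c \<in> B"
      by (simp add: B_def)
    \<comment> \<open>These carry \<open>c\<close> through the factors of \<open>z\<close> by
      adjointness. Each \<open>\<sigma>\<close> preserves the inner product with \<open>f\<close>
      and each passage through \<open>y\<close> reverses its sign, so the two reversals
      cancel.\<close>
    define c1 where "c1 = \<rho> \<sigma> c"
    define c2 where "c2 = \<rho> y c1"
    define c3 where "c3 = \<rho> \<sigma> c2"
    have cB: "c1 \<in> B" "c2 \<in> B" "c3 \<in> B"
      unfolding c1_def c2_def c3_def using c \<sigma>B GB y(1) by auto
    have 1: "f \<bullet> c1 = f \<bullet> c" and 3: "f \<bullet> c3 = f \<bullet> c2"
      by (simp_all add: c1_def c3_def \<sigma>f flip: \<sigma>_adjoint)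
    have "\<rho> y f \<bullet> c2 = f \<bullet> c1"
      by (simp add: c2_def \<rho>_inner yc)
    then have 2: "(f \<bullet> c2) * (f \<bullet> c) < 0"
      using opp[OF cB(2)] 1 by simp
    have "c \<bullet> \<rho> z f = c1 \<bullet> \<rho> (inv y) (\<rho> \<sigma> (\<rho> y f))"
      unfolding z\<rho> c1_def by (rule \<sigma>_adjoint[symmetric])
    also have "\<dots> = c2 \<bullet> \<rho> \<sigma> (\<rho> y f)"
      unfolding c2_def by (rule \<rho>_adjoint(2)[OF yc, symmetric])
    also have "\<dots> = c3 \<bullet> \<rho> y f"
      unfolding c3_def by (rule \<sigma>_adjoint[symmetric])
    finally have "c \<bullet> \<rho> z f = \<rho> y f \<bullet> c3"
      by (simp add: inner_commute)
    moreover have "(f \<bullet> c2) * (\<rho> y f \<bullet> c3) < 0"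
      using opp[OF cB(3)] 3 by simp
    ultimately show "c \<bullet> f * (c \<bullet> \<rho> z f) > 0"
      using 2 by (auto simp: mult_less_0_iff zero_less_mult_iff inner_commute[of c f])
  qed
  have comm: "\<rho> y (\<rho> \<sigma> v) = \<rho> \<sigma> (\<rho> y v)" for v
  proof -
    have "\<rho> \<sigma> (\<rho> (inv y) (\<rho> \<sigma> (\<rho> y (\<rho> \<sigma> v)))) = \<rho> \<sigma> v"
      using z\<rho>[of "\<rho> \<sigma> v"] \<open>z = \<one>\<close> by simp
    then have "\<rho> y (\<rho> \<sigma> (\<rho> \<sigma> (\<rho> (inv y) (\<rho> \<sigma> (\<rho> y (\<rho> \<sigma> v)))))) = \<rho> y v"
      by simp
    then have "\<rho> \<sigma> (\<rho> y (\<rho> \<sigma> v)) = \<rho> y v"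
      using yc by simp
    then show ?thesis
      by (metis \<rho>_\<sigma>_\<sigma>)
  qed
  \<comment> \<open>The root \<open>b\<close> lies in the plane, so \<open>B\<close> is not empty
    and \<open>opp\<close> applies to it.\<close>
  have yf_ne: "\<rho> y f \<noteq> f"
  proof
    have "b \<bullet> v = 0" if "v \<in> U" for v
    proof -
      have "2 *\<^sub>R b = e + f"
        by (simp add: e_def f_def scaleR_2)
      then have "2 * (b \<bullet> v) = (e + f) \<bullet> v"
        by (metis inner_scaleR_left)
      then show ?thesis
        using that by (simp add: U_def inner_add_left inner_commute[of _ v] inner_add_right)
    qed
    then have "b \<in> B"
      using b by (simp add: B_def)
    moreover assume "\<rho> y f = f"
    ultimately show False
      using opp[of b] by (simp add: mult_less_0_iff)
  qed
  \<comment> \<open>\<open>y\<close> preserves the plane and commutes with \<open>\<sigma>\<close>,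
    so it scales \<open>e\<close> by 1 or -1. With 1 it would be nontrivial and fix the hyperplane
    orthogonal to \<open>f\<close>, making \<open>f\<close> proportional to a root.\<close>
  have ye: "\<rho> y e = - e"
  proof -
    have "\<rho> y e \<bullet> v = 0" if "v \<in> U" for v
      using that y'U[OF that] by (simp add: \<rho>_adjoint(2)[OF yc] U_def inner_commute[of e])
    then obtain s t where st: "\<rho> y e = s *\<^sub>R e + t *\<^sub>R f"
      using plane by blast
    have "- (s *\<^sub>R e + t *\<^sub>R f) = \<rho> \<sigma> (s *\<^sub>R e + t *\<^sub>R f)"
      using comm[of e] \<sigma>e lin(4)[OF yc] by (simp add: st)
    also have "\<dots> = - (s *\<^sub>R e) + t *\<^sub>R f"
      by (simp add: lin \<sigma>e \<sigma>f)
    finally have "t *\<^sub>R f = - (t *\<^sub>R f)"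
      by (simp add: algebra_simps)
    then have "t *\<^sub>R f + t *\<^sub>R f = 0"
      by (simp only: eq_neg_iff_add_eq_0)
    then have "t *\<^sub>R f = 0"
      by (simp flip: scaleR_add_left)
    then have se: "\<rho> y e = s *\<^sub>R e"
      by (simp add: st)
    have "s * s = 1"
      using \<rho>_inner[OF yc, of e e] e0 by (simp add: se)
    moreover have "s \<noteq> 1"
    proof
      assume "s = 1"
      have "y \<noteq> \<one>"
        using yf_ne by auto
      moreover have "\<rho> y v = v" if v: "v \<bullet> f = 0" for v
      proof -
        define k where "k = (v \<bullet> e) / (e \<bullet> e)"
        have "v - k *\<^sub>R e \<in> U"
          using v e0 ef by (simp add: U_def k_def inner_diff_left)
        then have "\<rho> y (v - k *\<^sub>R e) = v - k *\<^sub>R e"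
          by (rule yU)
        then show ?thesis
          using se \<open>s = 1\<close> by (simp add: lin yc)
      qed
      ultimately show False
        using reflection_fixing_hyperplane[OF yc, of f] not_f by blast
    qed
    ultimately have "s = -1"
      by (simp add: square_eq_1_iff)
    with se show ?thesis by simp
  qed
  have "\<rho> y a \<in> span D" if "a \<in> D" for a
    using comm[of a] that by (simp add: \<sigma>_simple lin yc flip: \<sigma>_neg_iff)
  then have "y \<in> normalizer W WJ"
    using yc normalizer_iff by blast
  then obtain w x where w: "w \<in> WJ" and x: "x \<in> N_set W S J" and wx: "y = w \<otimes> x"
    using normalizer_decomposition by blast
  have wc: "w \<in> carrier W" and xc: "x \<in> carrier W"
    using w x by (auto simp: WJ_carrier N_set_iff)
  \<comment> \<open>By assumption the factor \<open>x\<close> is trivial on \<open>span D\<close>,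
    so there \<open>w\<close> inherits the action of \<open>y\<close>.\<close>
  have w_y: "\<rho> w v = \<rho> y v" if "v \<in> span D" for v
    using fixes_span[OF xc fixed[OF x] that] wc xc by (simp add: wx \<rho>_mult)
  have e_span: "e \<in> span D"
    using \<sigma>e \<sigma>_neg_iff by blast
  have "w \<noteq> \<one>"
  proof
    assume "w = \<one>"
    then have "e = - e"
      using w_y[OF e_span] ye by simp
    then have "e \<bullet> e = - (e \<bullet> e)"
      by (metis inner_minus_left)
    with e0 show False by simp
  qed
  moreover have "\<rho> w v = v" if v: "v \<bullet> e = 0" for v
  proof -
    \<comment> \<open>\<open>v1\<close> lies in \<open>span D\<close> and in \<open>U\<close>, so
      \<open>w\<close> acts on it as \<open>y\<close> does, trivially; \<open>v2\<close> is
      orthogonal to \<open>D\<close> and fixed by all of \<open>WJ\<close>.\<close>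
    define v1 where "v1 = (1/2) *\<^sub>R (v - \<rho> \<sigma> v)"
    define v2 where "v2 = (1/2) *\<^sub>R (v + \<rho> \<sigma> v)"
    have sum: "v = v1 + v2"
      by (simp add: v1_def v2_def algebra_simps flip: scaleR_add_left)
    have v1: "\<rho> \<sigma> v1 = - v1" and v2: "\<rho> \<sigma> v2 = v2"
      by (simp_all add: v1_def v2_def lin algebra_simps)
    have "v1 \<bullet> e = 0"
      using v by (simp add: v1_def inner_diff_left \<sigma>_adjoint \<sigma>e)
    moreover have "v1 \<bullet> f = 0"
      using \<sigma>_adjoint[of v1 f] by (simp add: v1 \<sigma>f)
    ultimately have "\<rho> y v1 = v1"
      by (intro yU) (simp add: U_def)
    then have "\<rho> w v1 = v1"
      using w_y[of v1] v1 \<sigma>_neg_iff by simp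
    moreover have "\<rho> w v2 = v2"
      using WJ_fixes_perp[OF w] v2 \<sigma>_fix_iff by blast
    ultimately show ?thesis
      by (simp add: sum lin wc)
  qed
  ultimately show False
    using reflection_fixing_hyperplane[OF wc, of e] not_e by blast
qed

lemma special_iff_bulky: "special_involution W \<Phi> \<rho> \<sigma> \<longleftrightarrow> bulky W S J"
  unfolding bulky_iff using special_imp_fixes fixes_imp_special by blast

end

theorem theorem2p3:
  fixes W :: "('w, 'm) monoid_scheme"
    and S J :: "'w set"
    and \<Phi> :: "'v::euclidean_space set"
    and \<rho> :: "'w \<Rightarrow> 'v \<Rightarrow> 'v"
  assumes "coxeter_system W S"
    and "finite (carrier W)"
    and "root_system_for W S \<Phi> \<rho>"
    and "J \<subseteq> S"
    and "\<forall>x\<in>generate W J.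
           longest_element W S J \<otimes>\<^bsub>W\<^esub> x = x \<otimes>\<^bsub>W\<^esub> longest_element W S J"
  shows "special_involution W \<Phi> \<rho> (longest_element W S J) \<longleftrightarrow> bulky W S J"
proof -
  obtain \<Delta> where \<Delta>: "simple_roots \<Phi> \<Delta>" "\<rho> ` S = reflection ` \<Delta>"
    using assms(3) by (auto simp: root_system_for_def)
  obtain h where h: "\<forall>a\<in>\<Delta>. h \<bullet> a = 1"
    using independent_dual_vector[of \<Delta>] \<Delta>(1) unfolding simple_roots_def by blast
  interpret group W
    using assms(1) by (simp add: coxeter_system_def)
  interpret coxeter_rep W S \<Phi> \<Delta> \<rho> h
    by unfold_locales
      (use assms(1-3) \<Delta> h in \<open>auto simp: coxeter_system_def root_system_for_def\<close>)
  \<comment> \<open>\<open>D\<close> is the set of simple roots whose reflections form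
    \<open>J\<close>.\<close>
  obtain D where D: "D \<subseteq> \<Delta>" "J = refl ` D"
    using assms(4) S_eq by (metis subset_imageE)
  interpret central_parabolic W S \<Phi> \<Delta> \<rho> h D
    by unfold_locales (use D assms(5) in auto)
  show ?thesis
    using special_iff_bulky by (simp add: \<sigma>_def D(2))
qed

end
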